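(* Let $(G_t)_{t=0}^N$, $N=\binom n2$, be the random graph process on $n$ vertices. Let $\tau_{\mathcal{D}}$ be the smallest $t$ such that $\mathrm{diam}(G_t)\le 2$, and $\tau_{\mathcal{R}}$ the smallest $t$ such that $\mathrm{rc}(G_t)\le 2$. Then with high probability $\tau_{\mathcal{D}}=\tau_{\mathcal{R}}$.
   Context: The random graph process starts with the empty graph on $n$ vertices at time $0$; at each step one edge, chosen uniformly at random among those not yet present, is added, until the complete graph is reached at time $N=\binom n2$. With high probability means with probability tending to $1$ as $n\to\infty$. Given an edge colouring, a rainbow path is a path whose edges have distinct colours; $\mathrm{rc}(G)$ is the minimum number of colours in an edge colouring of $G$ in which every pair of vertices is joined by at least one rainbow path. *)

theory Defs
  imports "HOL-Probability.Probability"
begin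

text \<open>
  A simple graph is given by a vertex set and a set of edges, the edges being
  two-element sets of vertices.
\<close>

definition complete_edges :: "nat \<Rightarrow> nat set set" where
  "complete_edges n = {e. e \<subseteq> {..<n} \<and> card e = 2}"

fun path_edges :: "'a list \<Rightarrow> 'a set list" where
  "path_edges (u # v # p) = {u, v} # path_edges (v # p)"
| "path_edges p = []"

definition paths_between :: "'a set \<Rightarrow> 'a set set \<Rightarrow> 'a \<Rightarrow> 'a \<Rightarrow> 'a list set" where
  "paths_between V E u v =
     {p. p \<noteq> [] \<and> hd p = u \<and> last p = v \<and> distinct p \<and> set p \<subseteq> V \<and> set (path_edges p) \<subseteq> E}"

text \<open>
  Distances, diameter and rainbow connection number are extended naturals: the
  infimum of the empty set is \<open>\<infinity>\<close>, so all of them are infinite when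
  the required paths do not exist.
\<close>

definition graph_dist :: "'a set \<Rightarrow> 'a set set \<Rightarrow> 'a \<Rightarrow> 'a \<Rightarrow> enat" where
  "graph_dist V E u v = (INF p\<in>paths_between V E u v. enat (length (path_edges p)))"

definition graph_diam :: "'a set \<Rightarrow> 'a set set \<Rightarrow> enat" where
  "graph_diam V E = (SUP u\<in>V. SUP v\<in>V. graph_dist V E u v)"

definition rainbow_path :: "('a set \<Rightarrow> 'c) \<Rightarrow> 'a list \<Rightarrow> bool" where
  "rainbow_path c p \<longleftrightarrow> distinct (map c (path_edges p))"

definition rainbow_connecting :: "'a set \<Rightarrow> 'a set set \<Rightarrow> ('a set \<Rightarrow> 'c) \<Rightarrow> bool" where
  "rainbow_connecting V E c \<longleftrightarrow>
     (\<forall>u\<in>V. \<forall>v\<in>V. \<exists>p\<in>paths_between V E u v. rainbow_path c p)"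

definition rainbow_connection_number :: "'a set \<Rightarrow> 'a set set \<Rightarrow> enat" where
  "rainbow_connection_number V E =
     (INF k\<in>{k. \<exists>c :: 'a set \<Rightarrow> nat. c ` E \<subseteq> {..<k} \<and> rainbow_connecting V E c}. enat k)"

text \<open>
  A run of the random graph process on the vertices \<open>{..<n}\<close> is recorded as the
  list of edges in order of their arrival.
\<close>

primrec edge_process :: "nat \<Rightarrow> nat \<Rightarrow> nat set list pmf" where
  "edge_process n 0 = return_pmf []"
| "edge_process n (Suc t) =
     do {
       es \<leftarrow> edge_process n t;
       e \<leftarrow> pmf_of_set (complete_edges n - set es);
       return_pmf (es @ [e])
     }"

definition random_graph_process :: "nat \<Rightarrow> nat set list pmf" where
  "random_graph_process n = edge_process n (n choose 2)"

definition graph_at :: "nat set list \<Rightarrow> nat \<Rightarrow> nat set set" where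
  "graph_at es t = set (take t es)"

text \<open>
  The times below are well defined on every run: the last graph is complete, and a
  complete graph has diameter and rainbow connection number at most 1.
\<close>

definition diam_time :: "nat \<Rightarrow> nat set list \<Rightarrow> nat" where
  "diam_time n es = (LEAST t. graph_diam {..<n} (graph_at es t) \<le> 2)"

definition rainbow_time :: "nat \<Rightarrow> nat set list \<Rightarrow> nat" where
  "rainbow_time n es = (LEAST t. rainbow_connection_number {..<n} (graph_at es t) \<le> 2)"

end

theory Submission
  imports Defs "HOL-Real_Asymp.Real_Asymp"
begin

text \<open>
  Write \<open>L = ln n\<close>. Give every edge an independent mark in \<open>{0, 1, 2}\<close> and let \<open>G0\<close> and
  \<open>G1\<close> be the graphs of the edges with mark \<open>0\<close> and with mark at most \<open>1\<close>, with edge densities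
  \<open>1.41 sqrt (L / n)\<close> and \<open>1.45 sqrt (L / n)\<close>, just below and above the diameter two threshold
  \<open>sqrt (2 L / n)\<close>. Sorting a uniform order of the edges by marks gives the process, so \<open>G0\<close> and
  \<open>G1\<close> are two of its graphs; a second and a first moment bound put the hitting time of
  diameter two between them. It remains to see that, with high probability, every \<open>G\<close> between
  \<open>G0\<close> and \<open>G1\<close> of diameter two has a rainbow colouring with two colours.

  Call a pair of vertices low if it has fewer than \<open>0.03 L\<close> common neighbours in \<open>G0\<close>, and weak
  if it has fewer than \<open>0.73 L\<close>. Low pairs are so rare that their cherries (paths of length two)
  in \<open>G1\<close> never share an edge. Hence each non-adjacent low pair can pick one cherry of \<open>G\<close> and
  have its two edges coloured differently, and this fixes at most three edges at every vertex. The
  other pairs keep many cherries of \<open>G0\<close> without fixed edges, and the local lemma colours these: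
  a pair with \<open>k\<close> cherries fails with probability \<open>2 ^ (-k)\<close>, every edge lies in cherries of
  \<open>O(sqrt n * L)\<close> pairs, and \<open>0.73 ln 2 > 1 / 2\<close> while only boundedly many of these pairs are weak.
\<close>

section \<open>Independent marks\<close>

text \<open>The graph at the hitting time does not have independent edges. Randomness is therefore
  used only at the two fixed mark levels, and the rest is deterministic for all \<open>G\<close> in
  between: the cherries fed to the local lemma lie in \<open>G0\<close>, hence in every
  \<open>G\<close>, while low pairs are separated in \<open>G1\<close>, hence whatever cherry
  \<open>G\<close> happens to offer them. A random colouring alone cannot work, since the last pairs
  to come within distance two have hardly any cherries. The densities reflect
  \<open>1.41^2 < 2 < 1.45^2\<close>. The threshold \<open>0.73\<close> is squeezed from two sides:
  \<open>0.73 ln 2\<close> must exceed \<open>1/2\<close>, and each further weak pair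
  \<open>{s, t}\<close> with \<open>t\<close> adjacent to a given \<open>w\<close> must lower the
  exponent of \<open>n\<close> in the expected number of configurations. It changes it by 1 for the
  choice of \<open>t\<close>, by \<open>-1/2\<close> for the edge, and by about
  \<open>0.73 - (1 - 1/e) * 1.41^2\<close> for weakness, in total about \<open>-0.027\<close>. The
  threshold \<open>0.03\<close> has to be positive, so that \<open>2 ^ (-0.03 L)\<close> beats
  powers of \<open>L\<close>, yet so small that two low pairs joined by an edge do not
  occur.\<close>

lemma finite_set_Pi_pmf:
  assumes "finite I" "\<And>x. x \<in> I \<Longrightarrow> finite (set_pmf (q x))"
  shows "finite (set_pmf (Pi_pmf I d q))"
  using assms by (subst set_Pi_pmf) (auto intro!: finite_PiE_dflt)

lemma expectation_pair_pmf_mult: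
  fixes F :: "'a \<Rightarrow> real" and G :: "'b \<Rightarrow> real"
  assumes "finite (set_pmf M)" "finite (set_pmf N)"
  shows "measure_pmf.expectation (pair_pmf M N) (\<lambda>x. F (fst x) * G (snd x)) =
         measure_pmf.expectation M F * measure_pmf.expectation N G"
proof -
  have "measure_pmf.expectation (pair_pmf M N) (\<lambda>x. F (fst x) * G (snd x)) =
     (\<Sum>(a, b)\<in>set_pmf M \<times> set_pmf N. (pmf M a * F a) * (pmf N b * G b))"
    using assms by (subst integral_measure_pmf_real[where A = "set_pmf M \<times> set_pmf N"])
      (auto simp: pmf_pair intro!: sum.cong)
  also have "\<dots> = (\<Sum>a\<in>set_pmf M. pmf M a * F a) * (\<Sum>b\<in>set_pmf N. pmf N b * G b)"
    by (simp add: sum_product sum.cartesian_product)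
  also have "(\<Sum>a\<in>set_pmf M. pmf M a * F a) = measure_pmf.expectation M F"
    using assms by (subst integral_measure_pmf_real[where A = "set_pmf M"]) (auto simp: mult.commute)
  also have "(\<Sum>b\<in>set_pmf N. pmf N b * G b) = measure_pmf.expectation N G"
    using assms by (subst integral_measure_pmf_real[where A = "set_pmf N"]) (auto simp: mult.commute)
  finally show ?thesis .
qed

text \<open>Stands for measurability with respect to the coordinates in \<open>A\<close>:
  independence becomes disjointness of coordinate sets.\<close>

definition depends_only :: "'a set \<Rightarrow> (('a \<Rightarrow> 'b) \<Rightarrow> 'c) \<Rightarrow> bool" where
  "depends_only A F \<longleftrightarrow> (\<forall>f g. (\<forall>x\<in>A. f x = g x) \<longrightarrow> F f = F g)"

lemma depends_onlyD: "depends_only A F \<Longrightarrow> (\<And>x. x \<in> A \<Longrightarrow> f x = g x) \<Longrightarrow> F f = F g"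
  by (auto simp: depends_only_def)

lemma depends_only_prod:
  assumes "\<And>z. z \<in> Z \<Longrightarrow> depends_only (A z) (F z)"
  shows "depends_only (\<Union>z\<in>Z. A z) (\<lambda>f. \<Prod>z\<in>Z. F z f)"
  unfolding depends_only_def
  by (intro allI impI prod.cong refl depends_onlyD[OF assms]) auto

text \<open>Cutting \<open>I\<close> along \<open>A\<close> turns the product law into a pair of
  independent parts, of which \<open>F\<close> sees only the first and \<open>G\<close> only the
  second.\<close>

lemma expectation_Pi_pmf_mult:
  fixes F G :: "('a \<Rightarrow> 'b) \<Rightarrow> real"
  assumes I: "finite I" and q: "\<And>x. x \<in> I \<Longrightarrow> finite (set_pmf (q x))"
    and F: "depends_only A F" and G: "depends_only B G" and AB: "A \<inter> B = {}"
  shows "measure_pmf.expectation (Pi_pmf I d q) (\<lambda>f. F f * G f) =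
         measure_pmf.expectation (Pi_pmf I d q) F * measure_pmf.expectation (Pi_pmf I d q) G"
proof -
  define J K where "J = I \<inter> A" and "K = I - A"
  have IJK: "I = J \<union> K" "J \<inter> K = {}" "finite J" "finite K"
    using I by (auto simp: J_def K_def)
  let ?m = "\<lambda>(f, g) x. if x \<in> J then f x else g x"
  let ?P = "pair_pmf (Pi_pmf J d q) (Pi_pmf K d q)"
  have fin: "finite (set_pmf (Pi_pmf J d q))" "finite (set_pmf (Pi_pmf K d q))"
    using q IJK by (auto intro!: finite_set_Pi_pmf)
  have eqP: "Pi_pmf I d q = map_pmf ?m ?P"
    unfolding IJK(1) by (rule Pi_pmf_union) (use IJK in auto)
  \<comment> \<open>\<open>A\<close> and \<open>B\<close> may reach outside \<open>I\<close>. There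
    both parts and the merged function all take the default value \<open>d\<close>, so nothing
    changes.\<close>
  have 1: "F (?m x) = F (fst x)" "G (?m x) = G (snd x)" if "x \<in> set_pmf ?P" for x
  proof -
    have x: "\<And>e. e \<notin> J \<Longrightarrow> fst x e = d" "\<And>e. e \<notin> K \<Longrightarrow> snd x e = d"
      using that set_Pi_pmf_subset[OF IJK(3), of d q] set_Pi_pmf_subset[OF IJK(4), of d q] by auto
    show "F (?m x) = F (fst x)"
      by (rule depends_onlyD[OF F]) (use x in \<open>auto simp: J_def K_def split: prod.splits\<close>)
    show "G (?m x) = G (snd x)"
      by (rule depends_onlyD[OF G]) (use x AB in \<open>auto simp: J_def K_def split: prod.splits\<close>)
  qed
  have "measure_pmf.expectation (Pi_pmf I d q) (\<lambda>f. F f * G f) =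
        measure_pmf.expectation ?P (\<lambda>x. F (fst x) * G (snd x))"
    unfolding eqP integral_map_pmf
    by (intro integral_cong_AE) (auto simp: AE_measure_pmf_iff 1 simp del: set_pair_pmf)
  also have "\<dots> = measure_pmf.expectation ?P (\<lambda>x. F (fst x)) * measure_pmf.expectation ?P (\<lambda>x. G (snd x))"
    by (subst expectation_pair_pmf_mult[OF fin]) simp
  also have "measure_pmf.expectation ?P (\<lambda>x. F (fst x)) = measure_pmf.expectation (Pi_pmf I d q) F"
    unfolding eqP integral_map_pmf
    by (intro integral_cong_AE) (auto simp: AE_measure_pmf_iff 1 simp del: set_pair_pmf)
  also have "measure_pmf.expectation ?P (\<lambda>x. G (snd x)) = measure_pmf.expectation (Pi_pmf I d q) G"
    unfolding eqP integral_map_pmf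
    by (intro integral_cong_AE) (auto simp: AE_measure_pmf_iff 1 simp del: set_pair_pmf)
  finally show ?thesis .
qed

lemma expectation_Pi_pmf_prod:
  fixes F :: "'z \<Rightarrow> ('a \<Rightarrow> 'b) \<Rightarrow> real"
  assumes I: "finite I" and q: "\<And>x. x \<in> I \<Longrightarrow> finite (set_pmf (q x))"
    and Z: "finite Z" and F: "\<And>z. z \<in> Z \<Longrightarrow> depends_only (A z) (F z)"
    and dj: "disjoint_family_on A Z"
  shows "measure_pmf.expectation (Pi_pmf I d q) (\<lambda>f. \<Prod>z\<in>Z. F z f) =
         (\<Prod>z\<in>Z. measure_pmf.expectation (Pi_pmf I d q) (F z))"
  using Z F dj
proof (induction Z rule: finite_induct)
  case (insert z Z)
  have "measure_pmf.expectation (Pi_pmf I d q) (\<lambda>f. F z f * (\<Prod>z\<in>Z. F z f)) =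
     measure_pmf.expectation (Pi_pmf I d q) (F z) *
     measure_pmf.expectation (Pi_pmf I d q) (\<lambda>f. \<Prod>z\<in>Z. F z f)"
  proof (rule expectation_Pi_pmf_mult[OF I q])
    show "depends_only (A z) (F z)" using insert.prems by auto
    show "depends_only (\<Union>z\<in>Z. A z) (\<lambda>f. \<Prod>z\<in>Z. F z f)"
      by (rule depends_only_prod) (use insert.prems in auto)
    show "A z \<inter> (\<Union>z\<in>Z. A z) = {}"
      using insert.prems(2) insert.hyps(2) by (auto simp: disjoint_family_on_def)
  qed
  moreover have "disjoint_family_on A Z"
    using insert.prems(2) by (auto simp: disjoint_family_on_def)
  ultimately show ?case using insert by simp
qed simp

lemma expectation_Pi_pmf_indicators:
  assumes I: "finite I" and q: "finite (set_pmf q)" and A: "A \<subseteq> I"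
  shows "measure_pmf.expectation (Pi_pmf I d (\<lambda>_. q)) (\<lambda>f. \<Prod>e\<in>A. of_bool (f e \<in> Y)) =
         measure_pmf.prob q Y ^ card A"
proof -
  have "measure_pmf.expectation (Pi_pmf I d (\<lambda>_. q)) (\<lambda>f. \<Prod>e\<in>A. of_bool (f e \<in> Y)) =
        (\<Prod>e\<in>A. measure_pmf.expectation (Pi_pmf I d (\<lambda>_. q)) (\<lambda>f. of_bool (f e \<in> Y) :: real))"
    by (rule expectation_Pi_pmf_prod[where A = "\<lambda>e. {e}" and F = "\<lambda>e f. of_bool (f e \<in> Y)"])
       (use assms finite_subset in \<open>auto simp: depends_only_def disjoint_family_on_def\<close>)
  also have "\<dots> = (\<Prod>e\<in>A. measure_pmf.prob q Y)"
  proof (rule prod.cong[OF refl])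
    fix e assume "e \<in> A"
    then have "e \<in> I" using A by auto
    have "measure_pmf.expectation (Pi_pmf I d (\<lambda>_. q)) (\<lambda>f. of_bool (f e \<in> Y)) =
       measure_pmf.expectation (map_pmf (\<lambda>f. f e) (Pi_pmf I d (\<lambda>_. q))) (\<lambda>x. indicator Y x :: real)"
      by (simp add: indicator_def of_bool_def)
    also have "\<dots> = measure_pmf.prob q Y"
      using \<open>e \<in> I\<close> by (subst Pi_pmf_component[OF I]) simp
    finally show "measure_pmf.expectation (Pi_pmf I d (\<lambda>_. q)) (\<lambda>f. of_bool (f e \<in> Y)) = measure_pmf.prob q Y" .
  qed
  finally show ?thesis by simp
qed

section \<open>Marked edges\<close>

lemma finite_complete_edges [simp, intro]: "finite (complete_edges n)"
  by (rule finite_subset[of _ "Pow {..<n}"]) (auto simp: complete_edges_def)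

lemma card_complete_edges: "card (complete_edges n) = n choose 2"
  unfolding complete_edges_def using n_subsets[of "{..<n}" 2] by simp

lemma pair_in_complete_edges [simp]:
  "{u, v} \<in> complete_edges n \<longleftrightarrow> u < n \<and> v < n \<and> u \<noteq> v"
  by (auto simp: complete_edges_def card_2_iff doubleton_eq_iff)

section \<open>Cherries in a randomly marked graph and their exponential moments\<close>

definition edge_marks :: "nat \<Rightarrow> nat pmf \<Rightarrow> (nat set \<Rightarrow> nat) pmf" where
  "edge_marks n q = Pi_pmf (complete_edges n) 2 (\<lambda>_. q)"

definition marked :: "nat \<Rightarrow> nat set \<Rightarrow> (nat set \<Rightarrow> nat) \<Rightarrow> nat set set" where
  "marked n Y f = {e \<in> complete_edges n. f e \<in> Y}"

lemma finite_set_edge_marks: "finite (set_pmf q) \<Longrightarrow> finite (set_pmf (edge_marks n q))"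
  unfolding edge_marks_def by (intro finite_set_Pi_pmf) auto

lemma integrable_edge_marks [simp]:
  "finite (set_pmf q) \<Longrightarrow> integrable (measure_pmf (edge_marks n q)) (f :: _ \<Rightarrow> real)"
  by (intro integrable_measure_pmf_finite finite_set_edge_marks)

definition common_nbrs :: "nat set set \<Rightarrow> nat set \<Rightarrow> nat set" where
  "common_nbrs G h = {z. \<forall>s\<in>h. {z, s} \<in> G}"

lemma common_nbrs_pair: "z \<in> common_nbrs G {u, v} \<longleftrightarrow> {z, u} \<in> G \<and> {z, v} \<in> G"
  by (auto simp: common_nbrs_def)

lemma common_nbrs_Un: "common_nbrs G (h \<union> h') = common_nbrs G h \<inter> common_nbrs G h'"
  by (auto simp: common_nbrs_def)

lemma common_nbrs_subset:
  "G \<subseteq> complete_edges n \<Longrightarrow> h \<noteq> {} \<Longrightarrow> common_nbrs G h \<subseteq> {..<n}"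
  by (fastforce simp: common_nbrs_def)

lemma marked_subset: "marked n Y f \<subseteq> complete_edges n"
  by (auto simp: marked_def)

text \<open>For different \<open>z\<close> outside \<open>S\<close> the edges from \<open>z\<close>
  to \<open>S\<close> form disjoint families, so what happens at different middle vertices is
  independent.\<close>

lemma depends_only_common_nbrs:
  "h \<subseteq> S \<Longrightarrow> depends_only ((\<lambda>s. {z, s}) ` S) (\<lambda>f. z \<in> common_nbrs (marked n Y f) h)"
  unfolding depends_only_def common_nbrs_def marked_def mem_Collect_eq
  by (intro allI impI ball_cong) (auto simp: subset_iff)

lemma expectation_common_nbrs:
  assumes q: "finite (set_pmf q)" and z: "z < n" "z \<notin> h" and h: "h \<subseteq> {..<n}"
  shows "measure_pmf.expectation (edge_marks n q) (\<lambda>f. of_bool (z \<in> common_nbrs (marked n Y f) h)) =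
         measure_pmf.prob q Y ^ card h"
proof -
  let ?A = "(\<lambda>s. {z, s}) ` h"
  have inj: "inj_on (\<lambda>s. {z, s}) h" by (auto simp: inj_on_def doubleton_eq_iff)
  have fin: "finite h" using h finite_subset by blast
  have sub: "?A \<subseteq> complete_edges n" using z h by auto
  have "(\<lambda>f. of_bool (z \<in> common_nbrs (marked n Y f) h) :: real) = (\<lambda>f. \<Prod>e\<in>?A. of_bool (f e \<in> Y))"
  proof
    fix f
    have "(\<Prod>e\<in>?A. of_bool (f e \<in> Y)) = (of_bool (\<forall>e\<in>?A. f e \<in> Y) :: real)"
      using fin by (induction h rule: finite_induct) (auto simp: prod.insert_if)
    then show "of_bool (z \<in> common_nbrs (marked n Y f) h) = (\<Prod>e\<in>?A. of_bool (f e \<in> Y) :: real)"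
      using z h by (auto simp: common_nbrs_def marked_def subset_iff)
  qed
  then show ?thesis
    unfolding edge_marks_def using expectation_Pi_pmf_indicators[OF finite_complete_edges q sub, of 2 Y]
    by (simp add: card_image[OF inj])
qed

text \<open>For \<open>m > 0\<close> the bracket is at most \<open>1\<close>: this is Bonferroni's inequality for the union of
  \<open>m\<close> events that all occur.\<close>

lemma power_le_bonferroni:
  fixes \<theta> :: real and m :: nat
  assumes "0 \<le> \<theta>" "\<theta> \<le> 1"
  shows "\<theta> ^ m \<le> 1 - (1 - \<theta>) * (real m - real m * (real m - 1))"
proof (cases "m = 0")
  case False
  then have "1 \<le> real m" by simp
  then have "real m - real m * (real m - 1) \<le> 1"
    using mult_nonneg_nonneg[of "real m - 1" "real m - 1"] by (simp add: algebra_simps)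
  then have "(1 - \<theta>) * (real m - real m * (real m - 1)) \<le> (1 - \<theta>) * 1"
    using assms by (intro mult_left_mono) auto
  moreover have "\<theta> ^ m \<le> \<theta> ^ 1"
    using assms False by (intro power_decreasing) auto
  ultimately show ?thesis by simp
qed simp

lemma card_union_pairs:
  assumes "card h = 2" "card h' = 2" "h \<noteq> h'"
  shows "card (h \<union> h') \<ge> 3"
proof -
  have f: "finite h" "finite h'" using assms card.infinite by fastforce+
  have "h \<subset> h \<union> h'"
    using assms f card_subset_eq[of h h'] by auto
  then show ?thesis using psubset_card_mono[of "h \<union> h'" h] f assms by auto
qed

text \<open>The exponential moment contributed by a single middle vertex \<open>z\<close>. Different
  pairs may share vertices and so be dependent, but the union of two of them has at least three
  vertices; hence joint occurrence has probability at most \<open>p ^ 3\<close>, of lower order than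
  \<open>p\<^sup>2\<close>.\<close>

lemma expectation_power_common:
  fixes Y :: "nat set"
  assumes q: "finite (set_pmf q)" and \<theta>: "0 \<le> \<theta>" "\<theta> \<le> 1"
    and H: "\<And>h. h \<in> H \<Longrightarrow> h \<subseteq> S \<and> card h = 2" and S: "S \<subseteq> {..<n}" and z: "z \<in> {..<n} - S"
  defines "p \<equiv> measure_pmf.prob q Y"
  shows "measure_pmf.expectation (edge_marks n q)
           (\<lambda>f. \<theta> ^ card {h\<in>H. z \<in> common_nbrs (marked n Y f) h})
         \<le> 1 - (1 - \<theta>) * (real (card H) * p\<^sup>2 - (real (card H))\<^sup>2 * p ^ 3)"
proof -
  let ?J = "\<lambda>f h. of_bool (z \<in> common_nbrs (marked n Y f) h) :: real"
  let ?E = "measure_pmf.expectation (edge_marks n q)"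
  have p: "0 \<le> p" "p \<le> 1" by (auto simp: p_def)
  have "finite S" using S finite_subset by blast
  then have fH: "finite H" using H by (meson Pow_iff finite_Pow_iff finite_subset subsetI)
  have 1: "real (card {h\<in>H. z \<in> common_nbrs (marked n Y f) h}) = (\<Sum>h\<in>H. ?J f h)" for f
    using fH by (simp add: sum.If_cases of_bool_def Int_def)
  \<comment> \<open>If \<open>m\<close> of the events occur, then \<open>m * (m - 1)\<close> counts
    ordered pairs of distinct ones.\<close>
  have 2: "(\<Sum>h\<in>H. ?J f h) * ((\<Sum>h\<in>H. ?J f h) - 1) = (\<Sum>h\<in>H. \<Sum>h'\<in>H - {h}. ?J f (h \<union> h'))" for f
  proof -
    have "(\<Sum>h\<in>H. ?J f h) * (\<Sum>h\<in>H. ?J f h) = (\<Sum>h\<in>H. \<Sum>h'\<in>H. ?J f (h \<union> h'))"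
      by (auto simp: sum_product common_nbrs_Un intro!: sum.cong)
    also have "\<dots> = (\<Sum>h\<in>H. ?J f h + (\<Sum>h'\<in>H - {h}. ?J f (h \<union> h')))"
      by (intro sum.cong refl, subst sum.remove[OF fH]) auto
    finally show ?thesis by (simp add: sum.distrib algebra_simps)
  qed
  have "?E (\<lambda>f. \<theta> ^ card {h\<in>H. z \<in> common_nbrs (marked n Y f) h})
      \<le> ?E (\<lambda>f. 1 - (1 - \<theta>) * ((\<Sum>h\<in>H. ?J f h) - (\<Sum>h\<in>H. \<Sum>h'\<in>H - {h}. ?J f (h \<union> h'))))"
  proof (rule integral_mono)
    fix f
    show "\<theta> ^ card {h\<in>H. z \<in> common_nbrs (marked n Y f) h}
      \<le> 1 - (1 - \<theta>) * ((\<Sum>h\<in>H. ?J f h) - (\<Sum>h\<in>H. \<Sum>h'\<in>H - {h}. ?J f (h \<union> h')))"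
      using power_le_bonferroni[OF \<theta>, of "card {h\<in>H. z \<in> common_nbrs (marked n Y f) h}"]
      unfolding 1 2[symmetric] .
  qed (use q in auto)
  also have "\<dots> = 1 - (1 - \<theta>) * ((\<Sum>h\<in>H. ?E (\<lambda>f. ?J f h)) - (\<Sum>h\<in>H. \<Sum>h'\<in>H - {h}. ?E (\<lambda>f. ?J f (h \<union> h'))))"
    using q by (simp del: of_bool_eq_iff)
  also have "(\<Sum>h\<in>H. ?E (\<lambda>f. ?J f h)) = real (card H) * p\<^sup>2"
  proof -
    have "?E (\<lambda>f. ?J f h) = p\<^sup>2" if "h \<in> H" for h
      using expectation_common_nbrs[OF q, of z n h Y] H[OF that] S z by (auto simp: p_def)
    then show ?thesis by simp
  qed
  also have "1 - (1 - \<theta>) * (real (card H) * p\<^sup>2 - (\<Sum>h\<in>H. \<Sum>h'\<in>H - {h}. ?E (\<lambda>f. ?J f (h \<union> h'))))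
     \<le> 1 - (1 - \<theta>) * (real (card H) * p\<^sup>2 - (real (card H))\<^sup>2 * p ^ 3)"
  proof -
    have "?E (\<lambda>f. ?J f (h \<union> h')) \<le> p ^ 3" if "h \<in> H" "h' \<in> H - {h}" for h h'
    proof -
      have "?E (\<lambda>f. ?J f (h \<union> h')) = p ^ card (h \<union> h')"
        using expectation_common_nbrs[OF q, of z n "h \<union> h'" Y] H[of h] H[of h'] that S z
        by (auto simp: p_def)
      also have "\<dots> \<le> p ^ 3"
        using H[of h] H[of h'] that by (intro power_decreasing card_union_pairs p) auto
      finally show ?thesis .
    qed
    then have "(\<Sum>h\<in>H. \<Sum>h'\<in>H - {h}. ?E (\<lambda>f. ?J f (h \<union> h'))) \<le> (\<Sum>h\<in>H. \<Sum>h'\<in>H - {h}. p ^ 3)"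
      by (intro sum_mono) auto
    also have "\<dots> \<le> (\<Sum>h\<in>H. \<Sum>h'\<in>H. p ^ 3)"
      using p fH by (intro sum_mono sum_mono2) auto
    also have "\<dots> = (real (card H))\<^sup>2 * p ^ 3" by (simp add: power2_eq_square)
    finally show ?thesis using \<theta> by (intro diff_mono mult_left_mono) auto
  qed
  finally show ?thesis .
qed

lemma depends_only_comp: "depends_only A F \<Longrightarrow> depends_only A (\<lambda>f. g (F f))"
  unfolding depends_only_def by metis

text \<open>The edges of \<open>A\<close> lie inside \<open>S\<close>, each factor uses only the
  edges from its \<open>z\<close> to \<open>S\<close>, and these families are pairwise disjoint: the
  expectation factorises. The case \<open>\<theta> = 0\<close> is included, where
  \<open>0 ^ 0 = 1\<close> makes the product the indicator that no outside vertex is a common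
  neighbour; the second moment bound uses it.\<close>

lemma expectation_pattern:
  fixes Y :: "nat set"
  assumes q: "finite (set_pmf q)" and \<theta>: "0 \<le> \<theta>" "\<theta> \<le> 1"
    and H: "\<And>h. h \<in> H \<Longrightarrow> h \<subseteq> S \<and> card h = 2" and S: "S \<subseteq> {..<n}"
    and A: "A \<subseteq> complete_edges n" "\<And>e. e \<in> A \<Longrightarrow> e \<subseteq> S"
  defines "p \<equiv> measure_pmf.prob q Y"
  shows "measure_pmf.expectation (edge_marks n q)
           (\<lambda>f. of_bool (A \<subseteq> marked n X f) *
                (\<Prod>z\<in>{..<n} - S. \<theta> ^ card {h\<in>H. z \<in> common_nbrs (marked n Y f) h}))
         \<le> measure_pmf.prob q X ^ card A *
            (1 - (1 - \<theta>) * (real (card H) * p\<^sup>2 - (real (card H))\<^sup>2 * p ^ 3)) ^ (n - card S)"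
proof -
  let ?E = "measure_pmf.expectation (edge_marks n q)"
  let ?B = "\<lambda>z. (\<lambda>s. {z, s}) ` S"
  let ?F = "\<lambda>z f. \<theta> ^ card {h\<in>H. z \<in> common_nbrs (marked n Y f) h}"
  have fS: "finite S" using S finite_subset by blast
  have fA: "finite A" using A(1) finite_subset by blast
  have dF: "depends_only (?B z) (?F z)" for z
    unfolding depends_only_def
  proof (intro allI impI)
    fix f g :: "nat set \<Rightarrow> nat" assume "\<forall>x\<in>?B z. f x = g x"
    then have "{h\<in>H. z \<in> common_nbrs (marked n Y f) h} = {h\<in>H. z \<in> common_nbrs (marked n Y g) h}"
      using depends_onlyD[OF depends_only_common_nbrs, of _ S z f g n Y] H by blast
    then show "?F z f = ?F z g" by (rule arg_cong)
  qed
  have dA: "depends_only A (\<lambda>f. of_bool (A \<subseteq> marked n X f))"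
    unfolding depends_only_def by (auto simp: marked_def)
  have "?E (\<lambda>f. of_bool (A \<subseteq> marked n X f) * (\<Prod>z\<in>{..<n} - S. ?F z f)) =
        ?E (\<lambda>f. of_bool (A \<subseteq> marked n X f)) * ?E (\<lambda>f. \<Prod>z\<in>{..<n} - S. ?F z f)"
    unfolding edge_marks_def
  proof (rule expectation_Pi_pmf_mult[OF finite_complete_edges q dA])
    show "depends_only (\<Union>z\<in>{..<n} - S. ?B z) (\<lambda>f. \<Prod>z\<in>{..<n} - S. ?F z f)"
      by (rule depends_only_prod) (rule dF)
    show "A \<inter> (\<Union>z\<in>{..<n} - S. ?B z) = {}" using A by blast
  qed
  also have "?E (\<lambda>f. of_bool (A \<subseteq> marked n X f)) = measure_pmf.prob q X ^ card A"
  proof -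
    have "of_bool (A \<subseteq> marked n X f) = (\<Prod>e\<in>A. of_bool (f e \<in> X) :: real)" for f
    proof -
      have "(\<Prod>e\<in>A. of_bool (f e \<in> X)) = (of_bool (\<forall>e\<in>A. f e \<in> X) :: real)"
        using fA by (induction A rule: finite_induct) auto
      then show ?thesis using A by (auto simp: marked_def)
    qed
    then show ?thesis
      unfolding edge_marks_def using expectation_Pi_pmf_indicators[OF finite_complete_edges q A(1)] by simp
  qed
  also have "?E (\<lambda>f. \<Prod>z\<in>{..<n} - S. ?F z f) = (\<Prod>z\<in>{..<n} - S. ?E (?F z))"
    unfolding edge_marks_def
  proof (rule expectation_Pi_pmf_prod[OF finite_complete_edges q])
    show "disjoint_family_on ?B ({..<n} - S)"
      by (auto simp: disjoint_family_on_def doubleton_eq_iff)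
  qed (use dF in auto)
  also have "\<dots> \<le> (\<Prod>z\<in>{..<n} - S. 1 - (1 - \<theta>) * (real (card H) * p\<^sup>2 - (real (card H))\<^sup>2 * p ^ 3))"
  proof (rule prod_mono, intro conjI)
    fix z assume "z \<in> {..<n} - S"
    then show "?E (?F z) \<le> 1 - (1 - \<theta>) * (real (card H) * p\<^sup>2 - (real (card H))\<^sup>2 * p ^ 3)"
      unfolding p_def using q \<theta> H S by (intro expectation_power_common) auto
    show "0 \<le> ?E (?F z)" using \<theta> by (intro integral_nonneg_AE) auto
  qed
  also have "\<dots> = (1 - (1 - \<theta>) * (real (card H) * p\<^sup>2 - (real (card H))\<^sup>2 * p ^ 3)) ^ (n - card S)"
    using S fS by (simp add: card_Diff_subset)
  finally show ?thesis by (simp add: mult_left_mono)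
qed

text \<open>A Chernoff bound. On the event, the pairs in \<open>H\<close> have together at most
  \<open>card H * b\<close> cherries, so the product of the powers of \<open>\<theta>\<close> is at
  least \<theta> to that number; Markov's inequality does the rest.\<close>

lemma prob_pattern:
  fixes Y :: "nat set"
  assumes q: "finite (set_pmf q)" and \<theta>: "0 < \<theta>" "\<theta> \<le> 1"
    and H: "\<And>h. h \<in> H \<Longrightarrow> h \<subseteq> S \<and> card h = 2" and S: "S \<subseteq> {..<n}"
    and A: "A \<subseteq> complete_edges n" "\<And>e. e \<in> A \<Longrightarrow> e \<subseteq> S"
  defines "p \<equiv> measure_pmf.prob q Y"
  shows "measure_pmf.prob (edge_marks n q)
           {f. A \<subseteq> marked n X f \<and> (\<forall>h\<in>H. real (card (common_nbrs (marked n Y f) h)) < b)}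
         \<le> \<theta> powr (- (real (card H) * b)) * (measure_pmf.prob q X ^ card A *
            (1 - (1 - \<theta>) * (real (card H) * p\<^sup>2 - (real (card H))\<^sup>2 * p ^ 3)) ^ (n - card S))"
proof -
  let ?E = "measure_pmf.expectation (edge_marks n q)"
  let ?G = "\<lambda>f. \<Prod>z\<in>{..<n} - S. \<theta> ^ card {h\<in>H. z \<in> common_nbrs (marked n Y f) h}"
  let ?C = "\<lambda>f. (\<forall>h\<in>H. real (card (common_nbrs (marked n Y f) h)) < b)"
  have "finite S" using S finite_subset by blast
  then have fH: "finite H" using H by (meson Pow_iff finite_Pow_iff finite_subset subsetI)
  have G: "1 \<le> \<theta> powr (- (real (card H) * b)) * ?G f" if "?C f" for f
  proof -
    let ?N = "\<lambda>h. common_nbrs (marked n Y f) h"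
    \<comment> \<open>Double counting of cherries, by middle vertex and by pair of ends.\<close>
    have "(\<Sum>z\<in>{..<n} - S. card {h\<in>H. z \<in> ?N h}) = (\<Sum>h\<in>H. card {z\<in>{..<n} - S. z \<in> ?N h})"
    proof -
      have "(\<Sum>z\<in>{..<n} - S. card {h\<in>H. z \<in> ?N h}) = (\<Sum>z\<in>{..<n} - S. \<Sum>h\<in>H. of_bool (z \<in> ?N h))"
        using fH by (simp add: sum.If_cases of_bool_def Int_def)
      also have "\<dots> = (\<Sum>h\<in>H. \<Sum>z\<in>{..<n} - S. of_bool (z \<in> ?N h))" by (rule sum.swap)
      also have "\<dots> = (\<Sum>h\<in>H. card {z\<in>{..<n} - S. z \<in> ?N h})"
        by (simp add: sum.If_cases of_bool_def Int_def)
      finally show ?thesis .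
    qed
    also have "\<dots> \<le> (\<Sum>h\<in>H. card (?N h))"
    proof (rule sum_mono, rule card_mono)
      fix h assume "h \<in> H"
      then have "h \<noteq> {}" using H by force
      then show "finite (?N h)"
        by (intro finite_subset[OF common_nbrs_subset[OF marked_subset]]) auto
    qed auto
    finally have "real (\<Sum>z\<in>{..<n} - S. card {h\<in>H. z \<in> ?N h}) \<le> real (\<Sum>h\<in>H. card (?N h))"
      by (rule of_nat_mono)
    also have "\<dots> = (\<Sum>h\<in>H. real (card (?N h)))" by simp
    also have "\<dots> \<le> (\<Sum>h\<in>H. b)" using that by (intro sum_mono) (auto intro: less_imp_le)
    finally have le: "real (\<Sum>z\<in>{..<n} - S. card {h\<in>H. z \<in> ?N h}) \<le> real (card H) * b" by simp
    have "?G f = \<theta> powr real (\<Sum>z\<in>{..<n} - S. card {h\<in>H. z \<in> ?N h})"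
      using \<theta> by (subst powr_realpow) (auto simp: power_sum)
    also have "\<dots> \<ge> \<theta> powr (real (card H) * b)"
      using \<theta> le by (intro powr_mono') auto
    finally have "\<theta> powr (real (card H) * b) \<le> ?G f" .
    then have "\<theta> powr (- (real (card H) * b)) * \<theta> powr (real (card H) * b) \<le> \<theta> powr (- (real (card H) * b)) * ?G f"
      by (intro mult_left_mono) auto
    then show ?thesis using \<theta> by (simp add: powr_minus field_simps)
  qed
  have "measure_pmf.prob (edge_marks n q) {f. A \<subseteq> marked n X f \<and> ?C f}
      = ?E (\<lambda>f. of_bool (A \<subseteq> marked n X f \<and> ?C f))"
  proof -
    have "(\<lambda>f. of_bool (A \<subseteq> marked n X f \<and> ?C f) :: real) = indicator {f. A \<subseteq> marked n X f \<and> ?C f}"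
      by (auto simp: indicator_def)
    then show ?thesis by simp
  qed
  also have "\<dots> \<le> ?E (\<lambda>f. \<theta> powr (- (real (card H) * b)) * (of_bool (A \<subseteq> marked n X f) * ?G f))"
    using G \<theta> q by (intro integral_mono) (auto simp: prod_nonneg)
  also have "\<dots> = \<theta> powr (- (real (card H) * b)) * ?E (\<lambda>f. of_bool (A \<subseteq> marked n X f) * ?G f)"
    by simp
  also have "\<dots> \<le> \<theta> powr (- (real (card H) * b)) * (measure_pmf.prob q X ^ card A *
            (1 - (1 - \<theta>) * (real (card H) * p\<^sup>2 - (real (card H))\<^sup>2 * p ^ 3)) ^ (n - card S))"
    unfolding p_def using \<theta> H S A q by (intro mult_left_mono expectation_pattern) auto
  finally show ?thesis .
qed

text \<open>The entries of \<open>JA\<close> and \<open>JH\<close> are positions in the list \<open>xs\<close> of vertices; the pairs at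
  positions \<open>JA\<close> are edges of \<open>G\<close>, those at positions \<open>JH\<close> have few common neighbours in \<open>F\<close>.\<close>

definition has_pattern ::
  "nat \<Rightarrow> nat \<Rightarrow> (nat \<times> nat) set \<Rightarrow> (nat \<times> nat) set \<Rightarrow> real \<Rightarrow> nat set set \<Rightarrow> nat set set \<Rightarrow> bool" where
  "has_pattern n k JA JH b G F \<longleftrightarrow>
     (\<exists>xs. length xs = k \<and> distinct xs \<and> set xs \<subseteq> {..<n} \<and> (\<forall>(i, j)\<in>JA. {xs ! i, xs ! j} \<in> G) \<and>
       (\<forall>(i, j)\<in>JH. real (card (common_nbrs F {xs ! i, xs ! j})) < b))"

text \<open>A union bound over at most \<open>n ^ k\<close> placements. The condition
  \<open>i < j\<close> makes different positions give different pairs, so the cardinalities of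
  \<open>JA\<close> and \<open>JH\<close> survive the placement.\<close>

lemma prob_has_pattern:
  fixes Y :: "nat set"
  assumes q: "finite (set_pmf q)" and \<theta>: "0 < \<theta>" "\<theta> \<le> 1" and k: "k \<le> n"
    and JA: "JA \<subseteq> {(i, j). i < j \<and> j < k}" and JH: "JH \<subseteq> {(i, j). i < j \<and> j < k}"
  defines "p \<equiv> measure_pmf.prob q Y" and "r \<equiv> real (card JH)"
  shows "measure_pmf.prob (edge_marks n q) {f. has_pattern n k JA JH b (marked n X f) (marked n Y f)}
         \<le> real n ^ k * (\<theta> powr (- (r * b)) * (measure_pmf.prob q X ^ card JA *
            (1 - (1 - \<theta>) * (r * p\<^sup>2 - r\<^sup>2 * p ^ 3)) ^ (n - k)))" (is "_ \<le> _ * ?B")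
proof -
  let ?L = "{xs. length xs = k \<and> distinct xs \<and> set xs \<subseteq> {..<n}}"
  let ?e = "\<lambda>xs (i, j). {xs ! i, xs ! j}"
  let ?Q = "\<lambda>xs. {f. ?e xs ` JA \<subseteq> marked n X f \<and> (\<forall>h\<in>?e xs ` JH. real (card (common_nbrs (marked n Y f) h)) < b)}"
  have L: "?L \<subseteq> {xs. set xs \<subseteq> {..<n} \<and> length xs = k}" by auto
  then have fL: "finite ?L" by (rule finite_subset) (simp add: finite_lists_length_eq)
  have cL: "card ?L \<le> n ^ k"
    using card_mono[OF _ L] by (simp add: finite_lists_length_eq card_lists_length_eq)
  have Q: "measure_pmf.prob (edge_marks n q) (?Q xs) \<le> ?B" if "xs \<in> ?L" for xs
  proof -
    have inj: "inj_on (?e xs) {(i, j). i < j \<and> j < k}"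
      using that by (auto simp: inj_on_def doubleton_eq_iff nth_eq_iff_index_eq)
    have c: "card (?e xs ` JA) = card JA" "card (?e xs ` JH) = card JH" "card (set xs) = k"
      using inj_on_subset[OF inj] JA JH that by (auto simp: card_image distinct_card)
    have sub: "?e xs x \<subseteq> set xs \<and> card (?e xs x) = 2" if "x \<in> {(i, j). i < j \<and> j < k}" for x
      using that \<open>xs \<in> ?L\<close> by (auto simp: card_insert_if nth_eq_iff_index_eq)
    have sub': "h \<subseteq> set xs \<and> card h = 2" if "h \<in> ?e xs ` JA \<union> ?e xs ` JH" for h
      using sub JA JH that by blast
    have "measure_pmf.prob (edge_marks n q) (?Q xs) \<le>
        \<theta> powr (- (real (card (?e xs ` JH)) * b)) * (measure_pmf.prob q X ^ card (?e xs ` JA) *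
            (1 - (1 - \<theta>) * (real (card (?e xs ` JH)) * p\<^sup>2 - (real (card (?e xs ` JH)))\<^sup>2 * p ^ 3)) ^ (n - card (set xs)))"
      unfolding p_def
    proof (rule prob_pattern[OF q \<theta>])
      show "?e xs ` JA \<subseteq> complete_edges n"
        unfolding complete_edges_def using sub' that by blast
    qed (use sub' that in auto)
    then show ?thesis unfolding c r_def .
  qed
  have "{f. has_pattern n k JA JH b (marked n X f) (marked n Y f)} = (\<Union>xs\<in>?L. ?Q xs)"
    unfolding has_pattern_def by (auto simp: image_subset_iff)
  then have "measure_pmf.prob (edge_marks n q) {f. has_pattern n k JA JH b (marked n X f) (marked n Y f)}
     \<le> (\<Sum>xs\<in>?L. measure_pmf.prob (edge_marks n q) (?Q xs))"
    using measure_pmf.finite_measure_subadditive_finite[OF fL, of ?Q "edge_marks n q"] by simp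
  also have "\<dots> \<le> (\<Sum>xs\<in>?L. ?B)" by (intro sum_mono Q)
  also have "\<dots> = real (card ?L) * ?B" by simp
  also have "\<dots> \<le> real n ^ k * ?B"
  proof -
    \<comment> \<open>One placement exists, and its probability witnesses that the common bound is
      nonnegative, as the next multiplication requires.\<close>
    have "[0..<k] \<in> ?L" using k by auto
    then have "0 \<le> ?B" by (rule order_trans[OF measure_nonneg Q])
    moreover have "real (card ?L) \<le> real n ^ k" using cL by (metis of_nat_le_iff of_nat_power)
    ultimately show ?thesis by (rule mult_right_mono[rotated])
  qed
  finally show ?thesis .
qed

section \<open>Sorting the random process by marks\<close>

lemma ex_permutes_map:
  assumes "x \<in> permutations_of_set A" "y \<in> permutations_of_set A"
  obtains \<pi> where "\<pi> permutes A" "map \<pi> x = y"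
proof
  let ?\<pi> = "permutation_of_list (zip x y)"
  have xy: "distinct x" "distinct y" "set x = A" "set y = A"
    using assms by (auto simp: permutations_of_set_def)
  then have len: "length x = length y" by (metis distinct_card)
  show "?\<pi> permutes A"
    using xy len by (intro permutation_of_list_permutes) (auto simp: list_permutes_def)
  show "map ?\<pi> x = y"
    using xy len by (auto intro!: nth_equalityI simp: permutation_of_list_def map_of_zip_nth)
qed

text \<open>Permutations of \<open>A\<close> act transitively on its orders, so an invariant law
  gives all orders equal mass. This identifies both the edge process and its sorted variant without
  computing probabilities of runs.\<close>

lemma pmf_of_permutations_if_invariant:
  assumes A: "finite A" and sub: "set_pmf M \<subseteq> permutations_of_set A"
    and inv: "\<And>\<pi>. \<pi> permutes A \<Longrightarrow> map_pmf (map \<pi>) M = M"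
  shows "M = pmf_of_set (permutations_of_set A)"
proof -
  let ?S = "permutations_of_set A"
  have S: "finite ?S" "?S \<noteq> {}" using A by auto
  have eq: "pmf M x = pmf M y" if xy: "x \<in> ?S" "y \<in> ?S" for x y
  proof -
    obtain \<pi> where \<pi>: "\<pi> permutes A" "map \<pi> x = y" by (rule ex_permutes_map[OF xy])
    have "pmf M y = pmf (map_pmf (map \<pi>) M) (map \<pi> x)" using \<pi> inv by simp
    also have "\<dots> = pmf M x"
      using \<pi> by (intro pmf_map_inj') (simp add: permutes_inj)
    finally show ?thesis by simp
  qed
  obtain x0 where x0: "x0 \<in> ?S" using S by blast
  have "1 = (\<Sum>x\<in>?S. pmf M x)" using sum_pmf_eq_1[OF S(1) sub] by simp
  also have "\<dots> = (\<Sum>x\<in>?S. pmf M x0)" by (intro sum.cong refl eq x0)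
  finally have c: "pmf M x0 = 1 / card ?S" using S by (simp add: field_simps)
  show ?thesis
  proof (rule pmf_eqI)
    fix x show "pmf M x = pmf (pmf_of_set ?S) x"
    proof (cases "x \<in> ?S")
      case True then show ?thesis using eq[OF True x0] c S by simp
    next
      case False
      then have "x \<notin> set_pmf M" using sub by blast
      then show ?thesis using False S by (simp add: pmf_eq_0_set_pmf)
    qed
  qed
qed

lemma set_edge_process:
  assumes "t \<le> n choose 2" "es \<in> set_pmf (edge_process n t)"
  shows "length es = t \<and> distinct es \<and> set es \<subseteq> complete_edges n"
  using assms
proof (induction t arbitrary: es)
  case (Suc t)
  from Suc.prems(2) obtain es' e where e: "es' \<in> set_pmf (edge_process n t)"
    "e \<in> set_pmf (pmf_of_set (complete_edges n - set es'))" "es = es' @ [e]" by auto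
  have es': "length es' = t" "distinct es'" "set es' \<subseteq> complete_edges n"
    using Suc.IH[OF _ e(1)] Suc.prems(1) by auto
  then have "card (set es') < card (complete_edges n)"
    using Suc.prems(1) by (simp add: distinct_card card_complete_edges)
  then have "complete_edges n - set es' \<noteq> {}"
    using card_mono[of "set es'" "complete_edges n"] by fastforce
  then have "e \<in> complete_edges n - set es'" using e(2) by (subst (asm) set_pmf_of_set) auto
  then show ?case using e es' by auto
qed simp

lemma map_edge_process:
  assumes \<pi>: "\<pi> permutes complete_edges n" and t: "t \<le> n choose 2"
  shows "map_pmf (map \<pi>) (edge_process n t) = edge_process n t"
  using t
proof (induction t)
  case (Suc t)
  let ?E = "complete_edges n"
  have "map_pmf (map \<pi>) (edge_process n (Suc t)) =
    edge_process n t \<bind> (\<lambda>es. map_pmf \<pi> (pmf_of_set (?E - set es)) \<bind> (\<lambda>e. return_pmf (map \<pi> es @ [e])))"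
    by (simp add: map_bind_pmf bind_map_pmf)
  also have "\<dots> = edge_process n t \<bind> (\<lambda>es. pmf_of_set (?E - set (map \<pi> es)) \<bind> (\<lambda>e. return_pmf (map \<pi> es @ [e])))"
  proof (rule bind_pmf_cong[OF refl])
    fix es assume "es \<in> set_pmf (edge_process n t)"
    then have es: "length es = t" "distinct es" "set es \<subseteq> ?E"
      using set_edge_process[of t n es] Suc.prems by auto
    then have "card (set es) < card ?E"
      using Suc.prems(1) by (simp add: distinct_card card_complete_edges)
    then have ne: "?E - set es \<noteq> {}"
      using card_mono[of "set es" ?E] by fastforce
    have "map_pmf \<pi> (pmf_of_set (?E - set es)) = pmf_of_set (\<pi> ` (?E - set es))"
      using ne by (intro map_pmf_of_set_inj inj_on_subset[OF permutes_inj[OF \<pi>]]) auto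
    also have "\<pi> ` (?E - set es) = ?E - set (map \<pi> es)"
      using permutes_image[OF \<pi>] image_set_diff[OF permutes_inj[OF \<pi>]] by auto
    finally show "map_pmf \<pi> (pmf_of_set (?E - set es)) \<bind> (\<lambda>e. return_pmf (map \<pi> es @ [e])) =
       pmf_of_set (?E - set (map \<pi> es)) \<bind> (\<lambda>e. return_pmf (map \<pi> es @ [e]))" by simp
  qed
  also have "\<dots> = map_pmf (map \<pi>) (edge_process n t) \<bind> (\<lambda>es. pmf_of_set (?E - set es) \<bind> (\<lambda>e. return_pmf (es @ [e])))"
    by (simp add: bind_map_pmf)
  finally show ?case using Suc by simp
qed simp

lemma random_graph_process_eq_pmf_of_set:
  "random_graph_process n = pmf_of_set (permutations_of_set (complete_edges n))"
  unfolding random_graph_process_def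
proof (rule pmf_of_permutations_if_invariant)
  show "set_pmf (edge_process n (n choose 2)) \<subseteq> permutations_of_set (complete_edges n)"
  proof
    fix es assume "es \<in> set_pmf (edge_process n (n choose 2))"
    then have "length es = n choose 2" "distinct es" "set es \<subseteq> complete_edges n"
      using set_edge_process[of "n choose 2" n es] by auto
    then show "es \<in> permutations_of_set (complete_edges n)"
      using card_subset_eq[of "complete_edges n" "set es"]
      by (auto simp: permutations_of_set_def distinct_card card_complete_edges)
  qed
qed (auto simp: map_edge_process)

section \<open>Sorting by marks and the resulting coupling\<close>

lemma insort_key_map: "insort_key g (\<pi> x) (map \<pi> xs) = map \<pi> (insort_key (g \<circ> \<pi>) x xs)"
  by (induction xs) auto

lemma sort_key_map: "sort_key g (map \<pi> xs) = map \<pi> (sort_key (g \<circ> \<pi>) xs)"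
  by (induction xs) (auto simp: insort_key_map comp_def)

definition sorted_process :: "nat \<Rightarrow> nat pmf \<Rightarrow> nat set list pmf" where
  "sorted_process n q = do {
     f \<leftarrow> edge_marks n q;
     es \<leftarrow> pmf_of_set (permutations_of_set (complete_edges n));
     return_pmf (sort_key f es)
   }"

lemma map_edge_marks:
  assumes \<pi>: "\<pi> permutes complete_edges n"
  shows "map_pmf (\<lambda>f. f \<circ> \<pi>) (edge_marks n q) = edge_marks n q"
  unfolding edge_marks_def
  by (rule Pi_pmf_bij_betw[symmetric])
    (use \<pi> in \<open>auto simp: permutes_in_image intro: permutes_imp_bij\<close>)

text \<open>Permuting the edges permutes the marks and the order of equal marks at once, so the
  stable sort of a uniform order by independent marks is again uniform.\<close>

lemma sorted_process_eq: "sorted_process n q = random_graph_process n"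
  unfolding random_graph_process_eq_pmf_of_set
proof (rule pmf_of_permutations_if_invariant)
  let ?E = "complete_edges n"
  let ?U = "pmf_of_set (permutations_of_set ?E)"
  have U: "set_pmf ?U = permutations_of_set ?E" by (rule set_pmf_of_set) auto
  then show "set_pmf (sorted_process n q) \<subseteq> permutations_of_set ?E"
    by (auto simp: sorted_process_def permutations_of_set_def)
  fix \<pi> assume \<pi>: "\<pi> permutes ?E"
  have "map_pmf (map \<pi>) ?U = pmf_of_set (map \<pi> ` permutations_of_set ?E)"
    by (intro map_pmf_of_set_inj inj_on_subset[OF inj_mapI[OF permutes_inj[OF \<pi>]]]) auto
  then have mU: "map_pmf (map \<pi>) ?U = ?U"
    using permutations_of_set_image_permutes[OF \<pi>] by simp
  have "sorted_process n q = map_pmf (\<lambda>f. f \<circ> inv \<pi>) (edge_marks n q) \<bind>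
          (\<lambda>f. map_pmf (map \<pi>) ?U \<bind> (\<lambda>es. return_pmf (sort_key f es)))"
    unfolding sorted_process_def mU map_edge_marks[OF permutes_inv[OF \<pi>]] ..
  also have "\<dots> = edge_marks n q \<bind> (\<lambda>f. ?U \<bind> (\<lambda>es. return_pmf (sort_key (f \<circ> inv \<pi>) (map \<pi> es))))"
    by (simp add: bind_map_pmf)
  also have "\<dots> = map_pmf (map \<pi>) (sorted_process n q)"
    unfolding sorted_process_def sort_key_map
    by (simp add: map_bind_pmf comp_assoc permutes_inv_o[OF \<pi>])
  finally show "map_pmf (map \<pi>) (sorted_process n q) = sorted_process n q" ..
qed simp

lemma take_filter_sorted:
  fixes f :: "'a \<Rightarrow> nat"
  assumes "sorted (map f xs)"
  shows "take (length (filter (\<lambda>e. f e \<le> k) xs)) xs = filter (\<lambda>e. f e \<le> k) xs"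
  using assms
proof (induction xs)
  case (Cons x xs)
  show ?case
  proof (cases "f x \<le> k")
    case False
    then have "filter (\<lambda>e. f e \<le> k) xs = []"
      using Cons.prems by (auto simp: filter_empty_conv)
    then show ?thesis using False by simp
  qed (use Cons in auto)
qed simp

text \<open>The time is itself random: it is the number of edges with mark at most \<open>k\<close>,
  and these come first after sorting.\<close>

lemma graph_at_sort_key:
  fixes f :: "nat set \<Rightarrow> nat"
  assumes "es \<in> permutations_of_set (complete_edges n)"
  shows "\<exists>t. marked n {..k} f = graph_at (sort_key f es) t"
proof
  let ?xs = "sort_key f es"
  show "marked n {..k} f = graph_at ?xs (length (filter (\<lambda>e. f e \<le> k) ?xs))"
    unfolding graph_at_def take_filter_sorted[OF sorted_sort_key]
    using assms by (auto simp: marked_def permutations_of_set_def)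
qed

text \<open>The coupling. As the times at which the two mark graphs appear depend on the marks, the
  hypothesis must hold for every pair of times; in exchange the bound involves only graphs with
  independent edges.\<close>

lemma prob_process_le_prob_marks:
  fixes j k :: nat and Q :: "nat set set \<Rightarrow> nat set set \<Rightarrow> bool"
  assumes "\<And>es s t. es \<in> permutations_of_set (complete_edges n) \<Longrightarrow> bad es \<Longrightarrow>
              Q (graph_at es s) (graph_at es t)"
  shows "measure_pmf.prob (random_graph_process n) {es. bad es}
       \<le> measure_pmf.prob (edge_marks n q) {f. Q (marked n {..j} f) (marked n {..k} f)}"
proof -
  let ?U = "pmf_of_set (permutations_of_set (complete_edges n))"
  have U: "set_pmf ?U = permutations_of_set (complete_edges n)" by (rule set_pmf_of_set) auto
  let ?P = "pair_pmf (edge_marks n q) ?U"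
  have "random_graph_process n = map_pmf (\<lambda>(f, es). sort_key f es) ?P"
    unfolding sorted_process_eq[symmetric, of n q] sorted_process_def pair_pmf_def
    by (simp add: map_bind_pmf)
  then have "measure_pmf.prob (random_graph_process n) {es. bad es} =
     measure_pmf.prob ?P {(f, es). bad (sort_key f es)}"
    by (simp add: vimage_def case_prod_unfold)
  also have "\<dots> \<le> measure_pmf.prob ?P (fst -` {f. Q (marked n {..j} f) (marked n {..k} f)})"
  proof (rule measure_pmf.finite_measure_mono_AE)
    show "AE x in ?P. x \<in> {(f, es). bad (sort_key f es)} \<longrightarrow>
       x \<in> fst -` {f. Q (marked n {..j} f) (marked n {..k} f)}"
      unfolding AE_measure_pmf_iff
    proof (clarsimp simp: U simp del: set_pmf_of_set)
      fix f :: "nat set \<Rightarrow> nat" and es assume es: "es \<in> permutations_of_set (complete_edges n)" "bad (sort_key f es)"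
      then have "sort_key f es \<in> permutations_of_set (complete_edges n)"
        by (auto simp: permutations_of_set_def)
      then show "Q (marked n {..j} f) (marked n {..k} f)"
        using assms[OF _ es(2)] graph_at_sort_key[OF es(1)] by metis
    qed
  qed simp
  also have "\<dots> = measure_pmf.prob (map_pmf fst ?P) {f. Q (marked n {..j} f) (marked n {..k} f)}"
    by simp
  finally show ?thesis by (simp add: map_fst_pair_pmf)
qed

section \<open>Diameter and rainbow connection number two\<close>

lemma path_edges_length: "length (path_edges p) = length p - 1"
  by (induction p rule: path_edges.induct) auto

lemma short_path_cases:
  assumes "p \<in> paths_between V E u v" "length (path_edges p) \<le> 2"
  obtains "u = v" | "p = [u, v]" "u \<noteq> v" "{u, v} \<in> E"
  | w where "p = [u, w, v]" "u \<noteq> v" "{w, u} \<in> E" "{w, v} \<in> E"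
proof -
  have "p \<noteq> []" "length p \<le> 3" using assms by (auto simp: paths_between_def path_edges_length)
  then consider a where "p = [a]" | a b where "p = [a, b]" | a b c where "p = [a, b, c]"
    by (cases p; cases "tl p"; cases "tl (tl p)"; cases "tl (tl (tl p))") auto
  then show ?thesis
    using assms that by cases (auto simp: paths_between_def insert_commute)
qed

text \<open>The infimum of a nonempty set of extended naturals is attained, and that of the empty
  set is infinite.\<close>

lemma enat_Inf_le_iff:
  fixes A :: "enat set"
  shows "Inf A \<le> enat k \<longleftrightarrow> (\<exists>a\<in>A. a \<le> enat k)"
proof
  assume "Inf A \<le> enat k"
  then have "A \<noteq> {}" by (auto simp: top_enat_def)
  then have "Inf A \<in> A" by (simp add: Inf_enat_def) (metis LeastI ex_in_conv)
  then show "\<exists>a\<in>A. a \<le> enat k" using \<open>Inf A \<le> enat k\<close> by blast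
qed (meson Inf_lower order_trans)

lemma graph_dist_le_2_iff:
  assumes E: "E \<subseteq> complete_edges n" and uv: "u < n" "v < n"
  shows "graph_dist {..<n} E u v \<le> 2 \<longleftrightarrow> u = v \<or> {u, v} \<in> E \<or> common_nbrs E {u, v} \<noteq> {}"
proof
  assume "graph_dist {..<n} E u v \<le> 2"
  then obtain p where p: "p \<in> paths_between {..<n} E u v" "length (path_edges p) \<le> 2"
    unfolding graph_dist_def numeral_eq_enat enat_Inf_le_iff by auto
  then show "u = v \<or> {u, v} \<in> E \<or> common_nbrs E {u, v} \<noteq> {}"
    by (rule short_path_cases) (auto simp: common_nbrs_pair)
next
  assume *: "u = v \<or> {u, v} \<in> E \<or> common_nbrs E {u, v} \<noteq> {}"
  have "\<exists>p\<in>paths_between {..<n} E u v. length (path_edges p) \<le> 2"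
  proof (cases "u = v")
    case True then show ?thesis
      using uv by (intro bexI[of _ "[u]"]) (auto simp: paths_between_def)
  next
    case ne: False
    show ?thesis
    proof (cases "{u, v} \<in> E")
      case True then show ?thesis
        using uv ne by (intro bexI[of _ "[u, v]"]) (auto simp: paths_between_def)
    next
      case False
      then obtain w where w: "{w, u} \<in> E" "{w, v} \<in> E"
        using * ne by (auto simp: common_nbrs_pair)
      then have "w < n" "w \<noteq> u" "w \<noteq> v" using subsetD[OF E, of "{w, u}"] subsetD[OF E, of "{w, v}"] by auto
      then show ?thesis
        using uv ne w by (intro bexI[of _ "[u, w, v]"]) (auto simp: paths_between_def insert_commute)
    qed
  qed
  then show "graph_dist {..<n} E u v \<le> 2"
    unfolding graph_dist_def numeral_eq_enat enat_Inf_le_iff by auto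
qed

definition diam_le_2 :: "nat \<Rightarrow> nat set set \<Rightarrow> bool" where
  "diam_le_2 n E \<longleftrightarrow> (\<forall>h\<in>complete_edges n. h \<in> E \<or> common_nbrs E h \<noteq> {})"

lemma complete_edgesE:
  assumes "h \<in> complete_edges n"
  obtains u v where "h = {u, v}" "u < n" "v < n" "u \<noteq> v"
  using assms by (auto simp: complete_edges_def card_2_iff)

lemma graph_diam_le_2_iff:
  assumes E: "E \<subseteq> complete_edges n"
  shows "graph_diam {..<n} E \<le> 2 \<longleftrightarrow> diam_le_2 n E"
proof -
  have "graph_diam {..<n} E \<le> 2 \<longleftrightarrow> (\<forall>u<n. \<forall>v<n. graph_dist {..<n} E u v \<le> 2)"
    by (auto simp: graph_diam_def SUP_le_iff)
  also have "\<dots> \<longleftrightarrow> (\<forall>u<n. \<forall>v<n. u = v \<or> {u, v} \<in> E \<or> common_nbrs E {u, v} \<noteq> {})"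
    using graph_dist_le_2_iff[OF E] by simp
  also have "\<dots> \<longleftrightarrow> diam_le_2 n E"
    unfolding diam_le_2_def by (auto elim!: complete_edgesE)
  finally show ?thesis .
qed

lemma common_nbrs_mono: "E \<subseteq> E' \<Longrightarrow> common_nbrs E h \<subseteq> common_nbrs E' h"
  by (auto simp: common_nbrs_def)

lemma diam_le_2_mono:
  assumes "diam_le_2 n E" "E \<subseteq> E'"
  shows "diam_le_2 n E'"
  unfolding diam_le_2_def
proof
  fix h assume "h \<in> complete_edges n"
  then have "h \<in> E \<or> common_nbrs E h \<noteq> {}" using assms(1) unfolding diam_le_2_def by blast
  then show "h \<in> E' \<or> common_nbrs E' h \<noteq> {}"
    using common_nbrs_mono[OF assms(2), of h] assms(2) by blast
qed

lemma rainbow_connection_number_le_2_iff: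
  "rainbow_connection_number V E \<le> 2 \<longleftrightarrow>
     (\<exists>c :: 'a set \<Rightarrow> nat. c ` E \<subseteq> {..<2} \<and> rainbow_connecting V E c)"
  for V :: "'a set"
proof
  assume "rainbow_connection_number V E \<le> 2"
  then obtain k and c :: "'a set \<Rightarrow> nat" where kc: "k \<le> 2" "c ` E \<subseteq> {..<k}" "rainbow_connecting V E c"
    unfolding rainbow_connection_number_def numeral_eq_enat enat_Inf_le_iff by auto
  then have "c ` E \<subseteq> {..<2}" by fastforce
  then show "\<exists>c :: 'a set \<Rightarrow> nat. c ` E \<subseteq> {..<2} \<and> rainbow_connecting V E c"
    using kc by blast
next
  assume "\<exists>c :: 'a set \<Rightarrow> nat. c ` E \<subseteq> {..<2} \<and> rainbow_connecting V E c"
  then show "rainbow_connection_number V E \<le> 2"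
    unfolding rainbow_connection_number_def numeral_eq_enat by (intro INF_lower) auto
qed

text \<open>With two colours a rainbow path has at most two edges. This is the easy inequality
  between the hitting times.\<close>

lemma rainbow_connection_number_le_2D:
  assumes E: "E \<subseteq> complete_edges n" and rc: "rainbow_connection_number {..<n} E \<le> 2"
  shows "diam_le_2 n E"
proof -
  obtain c :: "nat set \<Rightarrow> nat" where c: "c ` E \<subseteq> {..<2}" "rainbow_connecting {..<n} E c"
    using rc unfolding rainbow_connection_number_le_2_iff by blast
  have "graph_dist {..<n} E u v \<le> 2" if "u < n" "v < n" for u v
  proof -
    have "\<exists>p\<in>paths_between {..<n} E u v. rainbow_path c p"
      using c(2) that by (simp add: rainbow_connecting_def)
    then obtain p where p: "p \<in> paths_between {..<n} E u v" "rainbow_path c p" by blast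
    have "set (map c (path_edges p)) \<subseteq> {..<2}"
      using p(1) c(1) by (auto simp: paths_between_def)
    then have "card (set (map c (path_edges p))) \<le> card {..<2::nat}"
      by (intro card_mono) auto
    then have "length (path_edges p) \<le> 2"
      using p(2) unfolding rainbow_path_def by (subst (asm) distinct_card) auto
    then show ?thesis
      using p(1) unfolding graph_dist_def numeral_eq_enat enat_Inf_le_iff by auto
  qed
  then have "graph_diam {..<n} E \<le> 2" by (auto simp: graph_diam_def SUP_le_iff)
  then show ?thesis using graph_diam_le_2_iff[OF E] by simp
qed

text \<open>Different colours force \<open>s\<close> and \<open>t\<close> to be the two distinct
  elements of \<open>h\<close>, so the pair need not be ordered.\<close>

lemma rainbow_connection_number_le_2I:
  fixes c :: "nat set \<Rightarrow> bool"
  assumes E: "E \<subseteq> complete_edges n"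
    and c: "\<And>h. h \<in> complete_edges n \<Longrightarrow> h \<notin> E \<Longrightarrow>
              \<exists>w\<in>common_nbrs E h. \<exists>s\<in>h. \<exists>t\<in>h. c {w, s} \<noteq> c {w, t}"
  shows "rainbow_connection_number {..<n} E \<le> 2"
  unfolding rainbow_connection_number_le_2_iff
proof (intro exI conjI)
  let ?c = "\<lambda>e. of_bool (c e) :: nat"
  show "?c ` E \<subseteq> {..<2}" by auto
  show "rainbow_connecting {..<n} E ?c"
    unfolding rainbow_connecting_def
  proof (intro ballI)
    fix u v assume uv: "u \<in> {..<n}" "v \<in> {..<n}"
    show "\<exists>p\<in>paths_between {..<n} E u v. rainbow_path ?c p"
    proof (cases "u = v")
      case True then show ?thesis
        using uv by (intro bexI[of _ "[u]"]) (auto simp: paths_between_def rainbow_path_def)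
    next
      case ne: False
      show ?thesis
      proof (cases "{u, v} \<in> E")
        case True then show ?thesis
          using uv ne by (intro bexI[of _ "[u, v]"]) (auto simp: paths_between_def rainbow_path_def)
      next
        case False
        then have "\<exists>w\<in>common_nbrs E {u, v}. \<exists>s\<in>{u, v}. \<exists>t\<in>{u, v}. c {w, s} \<noteq> c {w, t}"
          using uv ne by (intro c) auto
        then obtain w where w: "{w, u} \<in> E" "{w, v} \<in> E" "c {w, u} \<noteq> c {w, v}"
          unfolding common_nbrs_def by blast
        then have "w < n" "w \<noteq> u" "w \<noteq> v" using subsetD[OF E, of "{w, u}"] subsetD[OF E, of "{w, v}"] by auto
        then show ?thesis
          using uv ne w by (intro bexI[of _ "[u, w, v]"])
            (auto simp: paths_between_def rainbow_path_def insert_commute)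
      qed
    qed
  qed
qed

section \<open>The local lemma\<close>

text \<open>The version with a neighbourhood sum of probabilities. Avoiding other events at most
  doubles the chance of \<open>A i\<close>; this is stated as an inequality of products, which
  avoids conditional probabilities.\<close>

lemma local_lemma:
  fixes P :: "'a pmf" and A :: "'i \<Rightarrow> 'a set"
  assumes I: "finite I" and N: "\<And>i. i \<in> I \<Longrightarrow> i \<in> N i"
    and indep: "\<And>i S. i \<in> I \<Longrightarrow> S \<subseteq> I \<Longrightarrow> S \<inter> N i = {} \<Longrightarrow>
      measure_pmf.prob P (A i \<inter> (\<Inter>j\<in>S. - A j)) =
      measure_pmf.prob P (A i) * measure_pmf.prob P (\<Inter>j\<in>S. - A j)"
    and small: "\<And>i. i \<in> I \<Longrightarrow> (\<Sum>j\<in>N i \<inter> I. measure_pmf.prob P (A j)) \<le> 1 / 4"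
  shows "measure_pmf.prob P (\<Inter>j\<in>I. - A j) > 0"
proof -
  let ?B = "\<lambda>S. \<Inter>j\<in>S. - A j"
  let ?p = "measure_pmf.prob P"
  have A4: "?p (A i) \<le> 1 / 4" if "i \<in> I" for i
  proof -
    have "?p (A i) \<le> (\<Sum>j\<in>N i \<inter> I. ?p (A j))"
      using N that I by (intro member_le_sum) auto
    then show ?thesis using small[OF that] by simp
  qed
  have split: "?p (?B S) \<ge> ?p (?B T) - (\<Sum>j\<in>U. ?p (A j \<inter> ?B T))"
    if "S = U \<union> T" "finite U" for S T U
  proof -
    have "?B T \<subseteq> ?B S \<union> (\<Union>j\<in>U. A j \<inter> ?B T)" using that by auto
    then have "?p (?B T) \<le> ?p (?B S \<union> (\<Union>j\<in>U. A j \<inter> ?B T))"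
      by (intro measure_pmf.finite_measure_mono) auto
    also have "\<dots> \<le> ?p (?B S) + ?p (\<Union>j\<in>U. A j \<inter> ?B T)"
      by (intro measure_Un_le) auto
    also have "?p (\<Union>j\<in>U. A j \<inter> ?B T) \<le> (\<Sum>j\<in>U. ?p (A j \<inter> ?B T))"
      using that by (intro measure_pmf.finite_measure_subadditive_finite) auto
    finally show ?thesis by simp
  qed
  \<comment> \<open>Positivity and the factor 2 are proved together: removing one event from
    \<open>S\<close> costs at most half the probability, by the factor 2 for the smaller set and
    \<open>A4\<close>.\<close>
  have "?p (?B S) > 0 \<and> (\<forall>i\<in>I. ?p (A i \<inter> ?B S) \<le> 2 * ?p (A i) * ?p (?B S))" if "S \<subseteq> I" for S
    using that
  proof (induction "card S" arbitrary: S rule: less_induct)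
    case less
    have fS: "finite S" using less.prems I finite_subset by blast
    have "?p (?B S) > 0"
    proof (cases "S = {}")
      case False
      then obtain j where j: "j \<in> S" by blast
      have T: "card (S - {j}) < card S" "S - {j} \<subseteq> I"
        using card_Diff1_less[OF fS j] less.prems by auto
      note IH = less.hyps[OF T]
      have "?p (?B S) \<ge> ?p (?B (S - {j})) - ?p (A j \<inter> ?B (S - {j}))"
        using split[of S "{j}" "S - {j}"] j by auto
      moreover have "?p (A j \<inter> ?B (S - {j})) \<le> 2 * ?p (A j) * ?p (?B (S - {j}))"
        using IH j less.prems by auto
      moreover have "\<dots> \<le> 2 * (1 / 4) * ?p (?B (S - {j}))"
        using A4[of j] j less.prems by (intro mult_right_mono mult_left_mono) auto
      moreover have "0 < ?p (?B (S - {j}))" using IH by blast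
      ultimately show ?thesis by linarith
    qed simp
    moreover have "?p (A i \<inter> ?B S) \<le> 2 * ?p (A i) * ?p (?B S)" if i: "i \<in> I" for i
    proof (cases "S \<inter> N i = {}")
      case True
      then show ?thesis using indep[OF i less.prems True] by simp
    next
      case False
      \<comment> \<open>The events of \<open>?T\<close> are independent of \<open>A i\<close>.
        Adding back the neighbours in \<open>S\<close> costs at most a share
        \<open>2 * (1 / 4)\<close> of the probability of \<open>?B ?T\<close>, which is where the
        factor 2 reappears.\<close>
      let ?T = "S - N i"
      have T: "card ?T < card S" "?T \<subseteq> I"
        using False fS less.prems by (auto intro!: psubset_card_mono)
      note IH = less.hyps[OF T]
      have "(\<Sum>j\<in>S \<inter> N i. ?p (A j \<inter> ?B ?T)) \<le> (\<Sum>j\<in>S \<inter> N i. 2 * ?p (A j) * ?p (?B ?T))"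
        using IH less.prems by (intro sum_mono) auto
      also have "\<dots> = 2 * ?p (?B ?T) * (\<Sum>j\<in>S \<inter> N i. ?p (A j))"
        unfolding sum_distrib_left by (intro sum.cong refl) (simp add: mult_ac)
      also have "\<dots> \<le> 2 * ?p (?B ?T) * (\<Sum>j\<in>N i \<inter> I. ?p (A j))"
        using less.prems I by (intro mult_left_mono sum_mono2) auto
      also have "\<dots> \<le> 2 * ?p (?B ?T) * (1 / 4)"
        using small[OF i] by (intro mult_left_mono) auto
      finally have "?p (?B S) \<ge> ?p (?B ?T) / 2"
        using split[OF Int_Diff_Un[symmetric, of S "N i"]] fS by auto
      have "?p (A i \<inter> ?B S) \<le> ?p (A i \<inter> ?B ?T)"
        by (intro measure_pmf.finite_measure_mono) auto
      also have "\<dots> = ?p (A i) * ?p (?B ?T)"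
        using T by (intro indep i) auto
      also have "\<dots> \<le> ?p (A i) * (2 * ?p (?B S))"
        using \<open>?p (?B S) \<ge> ?p (?B ?T) / 2\<close> by (intro mult_left_mono) auto
      finally show ?thesis by (simp add: mult_ac)
    qed
    ultimately show ?case by blast
  qed
  then show ?thesis by blast
qed

lemma prob_Pi_pmf_conj:
  assumes I: "finite I" and q: "\<And>x. x \<in> I \<Longrightarrow> finite (set_pmf (q x))"
    and F: "depends_only A F" and G: "depends_only B G" and AB: "A \<inter> B = {}"
  shows "measure_pmf.prob (Pi_pmf I d q) {f. F f \<and> G f} =
         measure_pmf.prob (Pi_pmf I d q) {f. F f} * measure_pmf.prob (Pi_pmf I d q) {f. G f}"
proof -
  have E: "measure_pmf.prob (Pi_pmf I d q) {f. H f} = measure_pmf.expectation (Pi_pmf I d q) (\<lambda>f. of_bool (H f))" for H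
  proof -
    have "(\<lambda>f. of_bool (H f) :: real) = indicator {f. H f}" by (auto simp: indicator_def)
    then show ?thesis by simp
  qed
  show ?thesis unfolding E of_bool_conj
    by (rule expectation_Pi_pmf_mult[OF I q depends_only_comp[OF F] depends_only_comp[OF G] AB])
qed

text \<open>Since \<open>W\<close> avoids \<open>h\<close>, cherries with different middles have no
  edge in common; each is monochromatic with probability one half, independently.\<close>

lemma prob_monochromatic:
  assumes I: "finite I" and h: "card h = 2" and W: "finite W" "W \<inter> h = {}"
    and sub: "\<And>w s. w \<in> W \<Longrightarrow> s \<in> h \<Longrightarrow> {w, s} \<in> I"
  shows "measure_pmf.prob (Pi_pmf I False (\<lambda>_. bernoulli_pmf (1/2)))
           {f. \<forall>w\<in>W. \<forall>s\<in>h. \<forall>t\<in>h. f {w, s} = f {w, t}} = (1 / 2) ^ card W"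
proof -
  obtain a b where ab: "h = {a, b}" "a \<noteq> b" using h by (auto simp: card_2_iff)
  let ?P = "Pi_pmf I False (\<lambda>_. bernoulli_pmf (1/2))"
  let ?F = "\<lambda>w f. of_bool (f {w, a} = f {w, b}) :: real"
  have q: "finite (set_pmf (bernoulli_pmf (1/2)))" by simp
  have int: "integrable (measure_pmf ?P) g" for g :: "_ \<Rightarrow> real"
    using I by (intro integrable_measure_pmf_finite finite_set_Pi_pmf) auto
  have ind: "{f. \<forall>w\<in>W. \<forall>s\<in>h. \<forall>t\<in>h. f {w, s} = f {w, t}} = {f. \<forall>w\<in>W. f {w, a} = f {w, b}}"
    unfolding ab by auto
  have prd: "indicator {f. \<forall>w\<in>W. f {w, a} = f {w, b}} f = (\<Prod>w\<in>W. ?F w f)" for f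
    using W(1) by (induction W rule: finite_induct) (auto simp: indicator_def)
  have "measure_pmf.prob ?P {f. \<forall>w\<in>W. \<forall>s\<in>h. \<forall>t\<in>h. f {w, s} = f {w, t}} =
     measure_pmf.expectation ?P (indicator {f. \<forall>w\<in>W. f {w, a} = f {w, b}})"
    unfolding ind by simp
  also have "\<dots> = measure_pmf.expectation ?P (\<lambda>f. \<Prod>w\<in>W. ?F w f)"
    by (intro arg_cong[where f = "measure_pmf.expectation ?P"] ext prd)
  also have "\<dots> = (\<Prod>w\<in>W. measure_pmf.expectation ?P (?F w))"
    by (rule expectation_Pi_pmf_prod[OF I, where A = "\<lambda>w. {{w, a}, {w, b}}"])
       (use W ab in \<open>auto simp: depends_only_def disjoint_family_on_def doubleton_eq_iff\<close>)
  also have "\<dots> = (\<Prod>w\<in>W. 1 / 2)"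
  proof (rule prod.cong[OF refl])
    fix w assume w: "w \<in> W"
    let ?G = "\<lambda>Y f. \<Prod>e\<in>{{w, a}, {w, b}}. of_bool (f e \<in> Y) :: real"
    have ne: "{w, a} \<noteq> {w, b}" using ab by (auto simp: doubleton_eq_iff)
    have G: "measure_pmf.expectation ?P (?G {c}) = 1 / 4" for c
      using expectation_Pi_pmf_indicators[OF I q, of "{{w, a}, {w, b}}" False "{c}"] sub[OF w] ab ne
      by (cases c) (auto simp: measure_pmf_single power2_eq_square)
    \<comment> \<open>Equal colours means both true or both false, each with probability
      \<open>1 / 4\<close>.\<close>
    have "?F w = (\<lambda>f. ?G {True} f + ?G {False} f)"
      using ne by (auto simp: fun_eq_iff)
    then have "measure_pmf.expectation ?P (?F w) = measure_pmf.expectation ?P (\<lambda>f. ?G {True} f + ?G {False} f)"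
      by simp
    also have "\<dots> = measure_pmf.expectation ?P (?G {True}) + measure_pmf.expectation ?P (?G {False})"
      by (rule Bochner_Integration.integral_add[OF int int])
    finally show "measure_pmf.expectation ?P (?F w) = 1 / 2" unfolding G by simp
  qed
  finally show ?thesis by simp
qed

text \<open>The local lemma for fair colours, the bad event of \<open>h\<close> being that all
  cherries chosen for it are monochromatic. Events are neighbours if their cherries share an
  edge.\<close>

lemma ex_two_colouring:
  fixes W :: "'v set \<Rightarrow> 'v set" and I :: "'v set set"
  defines "D \<equiv> \<lambda>h. {{w, s} |w s. w \<in> W h \<and> s \<in> h}"
  assumes I: "finite I"
    and h: "\<And>h. h \<in> I \<Longrightarrow> card h = 2 \<and> finite (W h) \<and> W h \<inter> h = {} \<and> W h \<noteq> {}"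
    and small: "\<And>h. h \<in> I \<Longrightarrow> (\<Sum>h'\<in>{h'\<in>I. D h \<inter> D h' \<noteq> {}}. (1 / 2) ^ card (W h')) \<le> (1 / 4 :: real)"
  shows "\<exists>f :: 'v set \<Rightarrow> bool. \<forall>h\<in>I. \<exists>w\<in>W h. \<exists>s\<in>h. \<exists>t\<in>h. f {w, s} \<noteq> f {w, t}"
proof -
  have fD: "finite (D h)" if "h \<in> I" for h
  proof -
    have "D h = (\<lambda>(w, s). {w, s}) ` (W h \<times> h)" by (auto simp: D_def)
    moreover have "finite h" using h[OF that] card.infinite by fastforce
    ultimately show ?thesis using h[OF that] by simp
  qed
  define F where "F = (\<Union>h\<in>I. D h)"
  have F: "finite F" using I fD by (auto simp: F_def)
  define P where "P = Pi_pmf F False (\<lambda>_ :: 'v set. bernoulli_pmf (1/2))"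
  define mono where "mono h f \<longleftrightarrow> (\<forall>w\<in>W h. \<forall>s\<in>h. \<forall>t\<in>h. f {w, s} = f {w, t})" for h and f :: "'v set \<Rightarrow> bool"
  have dm: "depends_only (D h) (mono h)" for h
    unfolding depends_only_def
  proof (intro allI impI)
    fix f g :: "'v set \<Rightarrow> bool" assume "\<forall>x\<in>D h. f x = g x"
    then have "f {w, s} = g {w, s}" if "w \<in> W h" "s \<in> h" for w s
      using that by (auto simp: D_def)
    then show "mono h f = mono h g" by (simp add: mono_def)
  qed
  have pm: "measure_pmf.prob P {f. mono h f} = (1 / 2) ^ card (W h)" if "h \<in> I" for h
    unfolding P_def mono_def using h[OF that] that
    by (intro prob_monochromatic[OF F]) (auto simp: F_def D_def)
  have "measure_pmf.prob P (\<Inter>h\<in>I. - {f. mono h f}) > 0"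
  proof (rule local_lemma[OF I, where N = "\<lambda>h. {h'\<in>I. D h \<inter> D h' \<noteq> {}}"])
    show "i \<in> {h'\<in>I. D i \<inter> D h' \<noteq> {}}" if "i \<in> I" for i
    proof -
      have "i \<noteq> {}" using h[OF that] by auto
      then have "D i \<noteq> {}" using h[OF that] by (auto simp: D_def)
      then show ?thesis using that by auto
    qed
    show "(\<Sum>j\<in>{h'\<in>I. D i \<inter> D h' \<noteq> {}} \<inter> I. measure_pmf.prob P {f. mono j f}) \<le> 1 / 4" if "i \<in> I" for i
    proof -
      have "{h'\<in>I. D i \<inter> D h' \<noteq> {}} \<inter> I = {h'\<in>I. D i \<inter> D h' \<noteq> {}}" by auto
      then show ?thesis using small[OF that] pm by simp
    qed
    fix i S assume S: "i \<in> I" "S \<subseteq> I" "S \<inter> {h'\<in>I. D i \<inter> D h' \<noteq> {}} = {}"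
    have eq: "(\<Inter>j\<in>S. - {f. mono j f}) = {f. \<forall>j\<in>S. \<not> mono j f}"
      "{f. mono i f} \<inter> (\<Inter>j\<in>S. - {f. mono j f}) = {f. mono i f \<and> (\<forall>j\<in>S. \<not> mono j f)}" by auto
    show "measure_pmf.prob P ({f. mono i f} \<inter> (\<Inter>j\<in>S. - {f. mono j f})) =
       measure_pmf.prob P {f. mono i f} * measure_pmf.prob P (\<Inter>j\<in>S. - {f. mono j f})"
      unfolding eq(2) unfolding eq(1) P_def
    proof (rule prob_Pi_pmf_conj[OF F _ dm])
      show "depends_only (\<Union>j\<in>S. D j) (\<lambda>f. \<forall>j\<in>S. \<not> mono j f)"
        unfolding depends_only_def
      proof (intro allI impI)
        fix f g :: "'v set \<Rightarrow> bool" assume fg: "\<forall>x\<in>(\<Union>j\<in>S. D j). f x = g x"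
        have "mono j f = mono j g" if "j \<in> S" for j
          by (rule depends_onlyD[OF dm]) (use fg that in auto)
        then show "(\<forall>j\<in>S. \<not> mono j f) = (\<forall>j\<in>S. \<not> mono j g)" by simp
      qed
      show "D i \<inter> (\<Union>j\<in>S. D j) = {}" using S by blast
    qed simp
  qed
  then have "(\<Inter>h\<in>I. - {f. mono h f}) \<noteq> {}" by (metis measure_empty less_irrefl)
  then obtain f where "\<forall>h\<in>I. \<not> mono h f" by auto
  then show ?thesis unfolding mono_def by (intro exI[of _ f]) simp
qed

section \<open>Colouring graphs between a sparse pair\<close>

lemma sum_UN_le:
  fixes g :: "'b \<Rightarrow> real"
  assumes "finite A" "\<And>x. x \<in> A \<Longrightarrow> finite (B x)" "\<And>y. 0 \<le> g y"
  shows "sum g (\<Union>x\<in>A. B x) \<le> (\<Sum>x\<in>A. sum g (B x))"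
  using assms
proof (induction A rule: finite_induct)
  case (insert x A)
  have "sum g (B x \<union> (\<Union>x\<in>A. B x)) \<le> sum g (B x) + sum g (\<Union>x\<in>A. B x)"
    using insert by (subst sum_Un) (auto intro!: sum_nonneg)
  then show ?case using insert by simp
qed simp

text \<open>The summands \<open>6\<close> leave room for the cherries that meet an edge coloured beforehand: at most
  three at either end of a pair.\<close>

locale sparse_pair =
  fixes n :: nat and G0 G1 :: "nat set set" and lo hi \<Delta> :: real and C k0 k1 :: nat
  assumes G01: "G0 \<subseteq> G1" and G1: "G1 \<subseteq> complete_edges n"
    and low_disjoint: "\<And>h h' s. h \<in> complete_edges n \<Longrightarrow> h' \<in> complete_edges n \<Longrightarrow>
      card (common_nbrs G0 h) < lo \<Longrightarrow> card (common_nbrs G0 h') < lo \<Longrightarrow> s \<in> h \<Longrightarrow> s \<in> h' \<Longrightarrow> h = h'"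
    and low_apart: "\<And>h h' s s'. h \<in> complete_edges n \<Longrightarrow> h' \<in> complete_edges n \<Longrightarrow>
      card (common_nbrs G0 h) < lo \<Longrightarrow> card (common_nbrs G0 h') < lo \<Longrightarrow> h \<noteq> h' \<Longrightarrow>
      s \<in> h \<Longrightarrow> s' \<in> h' \<Longrightarrow> {s, s'} \<notin> G1"
    and low_middle: "\<And>h h' y. h \<in> complete_edges n \<Longrightarrow> h' \<in> complete_edges n \<Longrightarrow>
      card (common_nbrs G0 h) < lo \<Longrightarrow> card (common_nbrs G0 h') < lo \<Longrightarrow>
      y \<in> common_nbrs G1 h \<Longrightarrow> y \<in> common_nbrs G1 h' \<Longrightarrow> h = h'"
    and few_weak: "\<And>s w. s < n \<Longrightarrow> w < n \<Longrightarrow> s \<noteq> w \<Longrightarrow>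
      card {t. t \<noteq> s \<and> {w, t} \<in> G1 \<and> card (common_nbrs G0 {s, t}) < hi} \<le> C"
    and degree: "\<And>w. w < n \<Longrightarrow> card {t. {w, t} \<in> G1} \<le> \<Delta>"
    and k0: "0 < k0" "k0 + 6 \<le> lo" and k1: "k0 \<le> k1" "k1 + 6 \<le> hi"
    and small: "4 * k1 * (C / 2 ^ k0 + \<Delta> / 2 ^ k1) \<le> 1 / 4"
begin

definition low :: "nat set \<Rightarrow> bool" where
  "low h \<longleftrightarrow> h \<in> complete_edges n \<and> card (common_nbrs G0 h) < lo"

lemma finite_common_nbrs:
  assumes "G \<subseteq> complete_edges n" "h \<in> complete_edges n"
  shows "finite (common_nbrs G h)"
proof -
  have "h \<noteq> {}" using assms(2) by (auto simp: complete_edges_def)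
  then show ?thesis using common_nbrs_subset[OF assms(1)] finite_subset by blast
qed

text \<open>The pairs whose cherries use the edge \<open>{w, s}\<close> with middle \<open>w\<close>
  are the \<open>{s, t}\<close> with \<open>t\<close> a neighbour of \<open>w\<close>. There are at
  most \<open>\<Delta>\<close> of them, and at most \<open>C\<close> are weak and carry the larger
  weight.\<close>

lemma card_weak_incident:
  assumes I: "I \<subseteq> {h \<in> complete_edges n. \<not> low h}" and sw: "s < n" "w < n" "s \<noteq> w"
  defines "k \<equiv> \<lambda>h. if card (common_nbrs G0 h) < hi then k0 else k1"
  shows "(\<Sum>h\<in>{h\<in>I. \<exists>t. h = {s, t} \<and> {w, t} \<in> G1}. (1 / 2) ^ k h) \<le> C / 2 ^ k0 + \<Delta> / 2 ^ k1"
proof -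
  let ?J = "{h\<in>I. \<exists>t. h = {s, t} \<and> {w, t} \<in> G1}"
  let ?T = "{t. {w, t} \<in> G1}"
  let ?Tw = "{t. t \<noteq> s \<and> {w, t} \<in> G1 \<and> card (common_nbrs G0 {s, t}) < hi}"
  let ?weak = "\<lambda>h. real (card (common_nbrs G0 h)) < hi"
  have T: "finite ?T"
    by (rule finite_subset[of _ "{..<n}"]) (use G1 in auto)
  have "?J \<subseteq> (\<lambda>t. {s, t}) ` ?T" by auto
  then have J: "finite ?J" "card ?J \<le> card ?T"
    using T by (auto intro: finite_subset surj_card_le)
  have Jw: "{h\<in>?J. ?weak h} \<subseteq> (\<lambda>t. {s, t}) ` ?Tw"
  proof
    fix h assume h: "h \<in> {h\<in>?J. ?weak h}"
    then obtain t where t: "h = {s, t}" "{w, t} \<in> G1" by auto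
    have "h \<in> complete_edges n" using h I by blast
    then have "t \<noteq> s" using t(1) by auto
    then show "h \<in> (\<lambda>t. {s, t}) ` ?Tw" using t h by auto
  qed
  have "finite ?Tw" using T by (rule finite_subset[rotated]) auto
  then have cw: "card {h\<in>?J. ?weak h} \<le> C"
    using surj_card_le[OF _ Jw] few_weak[OF sw] by linarith
  have "(\<Sum>h\<in>?J. (1 / 2) ^ k h) \<le> (\<Sum>h\<in>?J. (if ?weak h then (1 / 2) ^ k0 else 0) + (1 / 2 :: real) ^ k1)"
    unfolding k_def by (intro sum_mono) auto
  also have "\<dots> = card {h\<in>?J. ?weak h} * (1 / 2) ^ k0 + card ?J * (1 / 2) ^ k1"
    using J by (simp add: sum.distrib sum.If_cases Int_def)
  also have "\<dots> \<le> C * (1 / 2) ^ k0 + \<Delta> * (1 / 2) ^ k1"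
    using cw J(2) degree[OF sw(2)] by (intro add_mono mult_right_mono) auto
  finally show ?thesis by (simp add: power_one_over)
qed

text \<open>Non-adjacent low pairs get one cherry of \<open>G\<close> each, coloured by hand; all
  other pairs that are not low rely on cherries of \<open>G0\<close> that avoid these edges. Taking
  exactly \<open>k0\<close> or \<open>k1\<close> cherries keeps the number of edges per event
  small.\<close>

lemma rainbow_if_diam:
  assumes G: "G0 \<subseteq> G" "G \<subseteq> G1" and diam: "diam_le_2 n G"
  shows "rainbow_connection_number {..<n} G \<le> 2"
proof -
  let ?E = "complete_edges n"
  define Dg where "Dg = {h. low h \<and> h \<notin> G}"
  define m where "m h = (SOME w. w \<in> common_nbrs G h)" for h
  define a where "a h = (SOME s. s \<in> h)" for h :: "nat set"
  have m: "m h \<in> common_nbrs G h" if "h \<in> Dg" for h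
  proof -
    have "common_nbrs G h \<noteq> {}" using that diam by (auto simp: Dg_def low_def diam_le_2_def)
    then show ?thesis unfolding m_def by (simp add: some_in_eq)
  qed
  have m1: "{m h, s} \<in> G1" if "h \<in> Dg" "s \<in> h" for h s
    using m[OF that(1)] that(2) G(2) by (auto simp: common_nbrs_def)
  have a: "a h \<in> h" if "h \<in> Dg" for h
  proof -
    have "h \<noteq> {}" using that by (auto simp: Dg_def low_def complete_edges_def)
    then show ?thesis unfolding a_def by (simp add: some_in_eq)
  qed
  \<comment> \<open>\<open>R\<close> holds the edges coloured by hand, \<open>red\<close> those
    among them that get the first colour: one edge of each chosen cherry.\<close>
  define R where "R = {{m h, s} |h s. h \<in> Dg \<and> s \<in> h}"
  define red where "red = {{m h, a h} |h. h \<in> Dg}"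
  have edge_ne: "x \<noteq> y" if "{x, y} \<in> G1" for x y
    using subsetD[OF G1 that] by auto
  have Dg_disj: "h = h'" if "h \<in> Dg" "h' \<in> Dg" "s \<in> h" "s \<in> h'" for h h' s
    using low_disjoint[of h h' s] that by (auto simp: Dg_def low_def)
  have Dg_mid: "h = h'" if "h \<in> Dg" "h' \<in> Dg" "m h = m h'" for h h'
  proof -
    have "m h \<in> common_nbrs G1 h" "m h \<in> common_nbrs G1 h'"
      using m[OF that(1)] m[OF that(2)] that(3) common_nbrs_mono[OF G(2)] by auto
    then show ?thesis using low_middle[of h h' "m h"] that by (auto simp: Dg_def low_def)
  qed
  \<comment> \<open>The chosen cherries share no edge. In the crossed case, where each middle is an
    end of the other pair, that edge joins the two pairs, which \<open>low_apart\<close> excludes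
    unless they coincide; then it would be a loop.\<close>
  have R_inj: "h = h' \<and> s = s'" if "h \<in> Dg" "h' \<in> Dg" "s \<in> h" "s' \<in> h'" "{m h, s} = {m h', s'}" for h h' s s'
  proof -
    consider "m h = m h'" "s = s'" | "m h = s'" "s = m h'"
      using \<open>{m h, s} = {m h', s'}\<close> by (auto simp: doubleton_eq_iff)
    then show ?thesis
    proof cases
      case 1 then show ?thesis using Dg_disj that by blast
    next
      case 2
      have "{s, s'} \<in> G1" using m1[OF that(1,3)] 2 by (simp add: insert_commute)
      then have "h = h'" using low_apart[of h h' s s'] that by (auto simp: Dg_def low_def)
      then have "{m h, m h} \<in> G1" using m1[OF that(2,4)] 2 by auto
      then show ?thesis using edge_ne by blast
    qed
  qed
  \<comment> \<open>\<open>x\<close> is an end of at most one chosen cherry, giving one edge, and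
    the middle of at most one, giving two.\<close>
  have touched: "card {w. {w, x} \<in> R} \<le> 3 \<and> finite {w. {w, x} \<in> R}" for x
  proof -
    define A where "A = {m h |h. h \<in> Dg \<and> x \<in> h}"
    define B where "B = \<Union>{h. h \<in> Dg \<and> m h = x}"
    have "\<exists>y. A \<subseteq> {y}"
    proof (cases "A = {}")
      case False
      then obtain h where "h \<in> Dg" "x \<in> h" by (auto simp: A_def)
      then have "A \<subseteq> {m h}" using Dg_disj unfolding A_def by blast
      then show ?thesis by blast
    qed simp
    then obtain y where A: "A \<subseteq> {y}" by blast
    have "\<exists>u v. B \<subseteq> {u, v}"
    proof (cases "B = {}")
      case False
      then obtain h where h: "h \<in> Dg" "m h = x" by (auto simp: B_def)
      then have "B \<subseteq> h" using Dg_mid unfolding B_def by blast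
      moreover have "h \<in> ?E" using h by (simp add: Dg_def low_def)
      then obtain u v where "h = {u, v}" by (rule complete_edgesE)
      ultimately show ?thesis by blast
    qed simp
    then obtain u v where B: "B \<subseteq> {u, v}" by blast
    have "{w. {w, x} \<in> R} \<subseteq> A \<union> B"
    proof
      fix w assume "w \<in> {w. {w, x} \<in> R}"
      then obtain h s where hs: "h \<in> Dg" "s \<in> h" "{w, x} = {m h, s}" by (auto simp: R_def)
      then consider "w = m h" "x = s" | "w = s" "x = m h" by (auto simp: doubleton_eq_iff)
      then show "w \<in> A \<union> B" using hs by cases (auto simp: A_def B_def)
    qed
    then have sub: "{w. {w, x} \<in> R} \<subseteq> {y, u, v}" using A B by blast
    then have "card {w. {w, x} \<in> R} \<le> card {y, u, v}" by (intro card_mono) auto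
    also have "\<dots> \<le> 3" by (simp add: card_insert_if)
    finally show ?thesis using finite_subset[OF sub] by simp
  qed
  define k where "k h = (if card (common_nbrs G0 h) < hi then k0 else k1)" for h
  define I where "I = {h \<in> ?E. \<not> low h}"
  have G0: "G0 \<subseteq> ?E" using G01 G1 by blast
  have "\<exists>W. W \<subseteq> common_nbrs G0 h - {w. \<exists>s\<in>h. {w, s} \<in> R} \<and> card W = k h \<and> finite W" if h: "h \<in> I" for h
  proof -
    have "h \<in> ?E" using h by (simp add: I_def)
    then obtain u v where uv: "h = {u, v}" by (rule complete_edgesE)
    let ?N = "common_nbrs G0 h" and ?X = "{w. \<exists>s\<in>h. {w, s} \<in> R}"
    have N: "finite ?N" using finite_common_nbrs[OF G0] h by (auto simp: I_def)
    have X: "?X = {w. {w, u} \<in> R} \<union> {w. {w, v} \<in> R}" by (auto simp: uv)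
    have "card ?X \<le> card {w. {w, u} \<in> R} + card {w. {w, v} \<in> R}"
      unfolding X by (rule card_Un_le)
    then have cX: "card ?X \<le> 6" "finite ?X" using touched[of u] touched[of v] X by auto
    have "card ?N - card ?X \<le> card (?N - ?X)" by (rule diff_card_le_card_Diff[OF cX(2)])
    moreover have "k h + 6 \<le> card ?N"
    proof -
      have "real (k h + 6) \<le> card ?N"
        using h k0 k1 by (auto simp: I_def low_def k_def)
      then show ?thesis by simp
    qed
    ultimately have "k h \<le> card (?N - ?X)" using cX by linarith
    then show ?thesis by (meson obtain_subset_with_card_n)
  qed
  then have "\<forall>h\<in>I. \<exists>W. W \<subseteq> common_nbrs G0 h - {w. \<exists>s\<in>h. {w, s} \<in> R} \<and> card W = k h \<and> finite W"
    by (rule ballI)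
  from bchoice[OF this] obtain W where W':
    "\<forall>h\<in>I. W h \<subseteq> common_nbrs G0 h - {w. \<exists>s\<in>h. {w, s} \<in> R} \<and> card (W h) = k h \<and> finite (W h)" ..
  have W: "W h \<subseteq> common_nbrs G0 h - {w. \<exists>s\<in>h. {w, s} \<in> R}" "card (W h) = k h" "finite (W h)"
    if "h \<in> I" for h
    using bspec[OF W' that] by blast+
  have WG: "{w, s} \<in> G0" "{w, s} \<notin> R" if "h \<in> I" "w \<in> W h" "s \<in> h" for h w s
    using W(1)[OF that(1)] that(2,3) by (auto simp: common_nbrs_def)
  have WE: "w < n \<and> s < n \<and> w \<noteq> s" if "h \<in> I" "w \<in> W h" "s \<in> h" for h w s
    using subsetD[OF G0 WG(1)[OF that]] by simp
  let ?D = "\<lambda>h. {{w, s} |w s. w \<in> W h \<and> s \<in> h}"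
  have "\<exists>f :: nat set \<Rightarrow> bool. \<forall>h\<in>I. \<exists>w\<in>W h. \<exists>s\<in>h. \<exists>t\<in>h. f {w, s} \<noteq> f {w, t}"
  proof (rule ex_two_colouring)
    show "finite I" by (simp add: I_def)
    fix h assume h: "h \<in> I"
    show "card h = 2 \<and> finite (W h) \<and> W h \<inter> h = {} \<and> W h \<noteq> {}"
    proof (intro conjI)
      show "card h = 2" using h by (simp add: I_def complete_edges_def)
      show "finite (W h)" by (rule W(3)[OF h])
      show "W h \<inter> h = {}" using WE[OF h] by blast
      have "card (W h) > 0" using W(2)[OF h] k0 k1 by (auto simp: k_def)
      then show "W h \<noteq> {}" by auto
    qed
    let ?J = "\<lambda>s w. {h'\<in>I. \<exists>t. h' = {s, t} \<and> {w, t} \<in> G1}"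
    have fh: "finite h" "card h = 2" using h by (auto simp: I_def complete_edges_def intro: finite_subset)
    \<comment> \<open>In the other cherry the shared edge may be used with the same middle
      \<open>w\<close> or with the roles of \<open>w\<close> and \<open>s\<close> exchanged.\<close>
    have sub: "{h'\<in>I. ?D h \<inter> ?D h' \<noteq> {}} \<subseteq> (\<Union>(w, s)\<in>W h \<times> h. ?J s w \<union> ?J w s)"
    proof
      fix h' assume "h' \<in> {h'\<in>I. ?D h \<inter> ?D h' \<noteq> {}}"
      then obtain w s w' s' where h': "h' \<in> I" "w \<in> W h" "s \<in> h" "w' \<in> W h'" "s' \<in> h'" "{w, s} = {w', s'}"
        by auto
      have "h' \<in> ?E" using h'(1) by (simp add: I_def)
      then obtain t where t: "h' = {s', t}"
        using h'(5) by (elim complete_edgesE) (metis insertE insert_commute singletonD)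
      then have w't: "{w', t} \<in> G1" using WG(1)[OF h'(1,4), of t] G01 by auto
      have "h' \<in> ?J s w \<union> ?J w s"
        using h'(6) t w't h'(1) by (auto simp: doubleton_eq_iff)
      then show "h' \<in> (\<Union>(w, s)\<in>W h \<times> h. ?J s w \<union> ?J w s)" using h' by blast
    qed
    have fJ: "finite (?J s w)" for s w by (auto simp: I_def)
    have "(\<Sum>h'\<in>{h'\<in>I. ?D h \<inter> ?D h' \<noteq> {}}. (1 / 2) ^ card (W h')) = (\<Sum>h'\<in>{h'\<in>I. ?D h \<inter> ?D h' \<noteq> {}}. (1 / 2 :: real) ^ k h')"
      using W(2) by (intro sum.cong) auto
    also have "\<dots> \<le> (\<Sum>h'\<in>(\<Union>(w, s)\<in>W h \<times> h. ?J s w \<union> ?J w s). (1 / 2) ^ k h')"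
      using W(3)[OF h] fh fJ by (intro sum_mono2[OF _ sub]) auto
    also have "\<dots> \<le> (\<Sum>x\<in>W h \<times> h. \<Sum>h'\<in>(case x of (w, s) \<Rightarrow> ?J s w \<union> ?J w s). (1 / 2) ^ k h')"
      using W(3)[OF h] fh by (intro sum_UN_le) (auto simp: I_def)
    also have "\<dots> \<le> (\<Sum>x\<in>W h \<times> h. 2 * (C / 2 ^ k0 + \<Delta> / 2 ^ k1))"
    proof (rule sum_mono)
      fix x assume x: "x \<in> W h \<times> h"
      obtain w s where ws: "x = (w, s)" "w \<in> W h" "s \<in> h" using x by auto
      have "(\<Sum>h'\<in>?J s w \<union> ?J w s. (1 / 2 :: real) ^ k h')
          \<le> (\<Sum>h'\<in>?J s w. (1 / 2) ^ k h') + (\<Sum>h'\<in>?J w s. (1 / 2) ^ k h')"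
        using fJ by (subst sum_Un) (auto intro!: sum_nonneg)
      also have "\<dots> \<le> 2 * (C / 2 ^ k0 + \<Delta> / 2 ^ k1)"
        using card_weak_incident[of I s w] card_weak_incident[of I w s] WE[OF h ws(2,3)]
        by (simp add: I_def k_def)
      finally show "(\<Sum>h'\<in>(case x of (w, s) \<Rightarrow> ?J s w \<union> ?J w s). (1 / 2) ^ k h')
          \<le> 2 * (C / 2 ^ k0 + \<Delta> / 2 ^ k1)" by (simp add: ws)
    qed
    \<comment> \<open>\<open>k h\<close> cherries with two edges each, and two orientations of every
      edge.\<close>
    also have "\<dots> = 4 * k h * (C / 2 ^ k0 + \<Delta> / 2 ^ k1)"
      using fh W(2)[OF h] by (simp add: card_cartesian_product)
    also have "\<dots> \<le> 4 * k1 * (C / 2 ^ k0 + \<Delta> / 2 ^ k1)"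
    proof -
      have "0 < n" using WE[OF h] fh \<open>card h = 2 \<and> finite (W h) \<and> W h \<inter> h = {} \<and> W h \<noteq> {}\<close>
        by fastforce
      then have "0 \<le> \<Delta>" using degree[of 0] by linarith
      then show ?thesis using k1(1) by (intro mult_right_mono) (auto simp: k_def)
    qed
    also have "\<dots> \<le> 1 / 4" by (rule small)
    finally show "(\<Sum>h'\<in>{h'\<in>I. ?D h \<inter> ?D h' \<noteq> {}}. (1 / 2) ^ card (W h')) \<le> (1 / 4 :: real)" .
  qed
  then obtain f :: "nat set \<Rightarrow> bool" where f: "\<And>h. h \<in> I \<Longrightarrow> \<exists>w\<in>W h. \<exists>s\<in>h. \<exists>t\<in>h. f {w, s} \<noteq> f {w, t}"
    by blast
  define c where "c e = (if e \<in> R then e \<in> red else f e)" for e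
  have GE: "G \<subseteq> ?E" using G(2) G1 by blast
  show ?thesis
  proof (rule rainbow_connection_number_le_2I[OF GE, of c])
    fix h assume h: "h \<in> ?E" "h \<notin> G"
    show "\<exists>w\<in>common_nbrs G h. \<exists>s\<in>h. \<exists>t\<in>h. c {w, s} \<noteq> c {w, t}"
    proof (cases "low h")
      case True
      then have hD: "h \<in> Dg" using h by (simp add: Dg_def)
      obtain t where t: "t \<in> h" "t \<noteq> a h"
        using h(1) by (elim complete_edgesE) (metis insertCI)
      have "{m h, a h} \<in> red" using hD by (auto simp: red_def)
      \<comment> \<open>If the second edge were red, it would be the red edge of the same cherry by
        \<open>R_inj\<close>, so \<open>t\<close> would be \<open>a h\<close>.\<close>
      moreover have "{m h, t} \<notin> red"
      proof
        assume "{m h, t} \<in> red"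
        then obtain h' where "h' \<in> Dg" "{m h, t} = {m h', a h'}" by (auto simp: red_def)
        then have "h = h' \<and> t = a h'" using R_inj[OF hD _ t(1) a] by blast
        then show False using t(2) by auto
      qed
      moreover have "{m h, a h} \<in> R" "{m h, t} \<in> R" using hD t(1) a[OF hD] by (auto simp: R_def)
      ultimately have "c {m h, a h} \<noteq> c {m h, t}" by (simp add: c_def)
      then show ?thesis using m[OF hD] a[OF hD] t(1) by blast
    next
      case False
      then have hI: "h \<in> I" using h by (simp add: I_def)
      obtain w s t where w: "w \<in> W h" "s \<in> h" "t \<in> h" "f {w, s} \<noteq> f {w, t}" using f[OF hI] by blast
      have "c {w, s} \<noteq> c {w, t}" using w WG(2)[OF hI w(1)] by (simp add: c_def)
      moreover have "w \<in> common_nbrs G h"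
        using WG(1)[OF hI w(1)] G(1) by (auto simp: common_nbrs_def)
      ultimately show ?thesis using w by blast
    qed
  qed
qed

end

section \<open>Probability bounds\<close>

lemma prob_eq_expectation_of_bool:
  "measure_pmf.prob M {x. H x} = measure_pmf.expectation M (\<lambda>x. of_bool (H x))"
proof -
  have "(\<lambda>x. of_bool (H x) :: real) = indicator {x. H x}" by (auto simp: indicator_def)
  then show ?thesis by simp
qed

lemma one_minus_power_le_exp:
  fixes x :: real
  assumes "x \<le> 1"
  shows "(1 - x) ^ m \<le> exp (- (x * m))"
proof -
  have "(1 - x) ^ m \<le> exp (- x) ^ m"
    using assms exp_ge_add_one_self[of "- x"] by (intro power_mono) auto
  then show ?thesis by (simp add: exp_of_nat_mult[symmetric] mult.commute)
qed

text \<open>\<open>\<sigma>\<close> bounds \<open>- ln \<theta>\<close> from above, so convenient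
  numbers can replace a logarithm in the exponent.\<close>

lemma prob_has_pattern_le:
  fixes Y :: "nat set"
  assumes q: "finite (set_pmf q)" and k: "k \<le> n"
    and \<theta>: "0 < \<theta>" "\<theta> \<le> 1" "exp (- \<sigma>) \<le> \<theta>" and b: "0 \<le> b"
    and JA: "JA \<subseteq> {(i, j). i < j \<and> j < k}" and JH: "JH \<subseteq> {(i, j). i < j \<and> j < k}"
    and r: "r = real (card JH)" and p: "p = measure_pmf.prob q Y"
    and le1: "(1 - \<theta>) * (r * p\<^sup>2 - r\<^sup>2 * p ^ 3) \<le> 1"
  shows "measure_pmf.prob (edge_marks n q) {f. has_pattern n k JA JH b (marked n X f) (marked n Y f)}
         \<le> real n ^ k * (exp (r * b * \<sigma>) * (measure_pmf.prob q X ^ card JA *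
             exp (- ((1 - \<theta>) * (r * p\<^sup>2 - r\<^sup>2 * p ^ 3) * (real n - k)))))"
proof -
  have "\<theta> powr (- (r * b)) = exp (- (r * b * ln \<theta>))" using \<theta> by (simp add: powr_def)
  also have "\<dots> \<le> exp (r * b * \<sigma>)"
  proof -
    have "- \<sigma> \<le> ln \<theta>" using \<theta> by (metis exp_le_cancel_iff exp_ln)
    then have "r * b * (- ln \<theta>) \<le> r * b * \<sigma>" using b r by (intro mult_left_mono) auto
    then show ?thesis by simp
  qed
  finally have 1: "\<theta> powr (- (r * b)) \<le> exp (r * b * \<sigma>)" .
  have 2: "(1 - (1 - \<theta>) * (r * p\<^sup>2 - r\<^sup>2 * p ^ 3)) ^ (n - k) \<le>
      exp (- ((1 - \<theta>) * (r * p\<^sup>2 - r\<^sup>2 * p ^ 3) * (real n - k)))"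
    using one_minus_power_le_exp[OF le1, of "n - k"] k by (simp add: of_nat_diff)
  have "measure_pmf.prob (edge_marks n q) {f. has_pattern n k JA JH b (marked n X f) (marked n Y f)}
     \<le> real n ^ k * (\<theta> powr (- (r * b)) * (measure_pmf.prob q X ^ card JA *
            (1 - (1 - \<theta>) * (r * p\<^sup>2 - r\<^sup>2 * p ^ 3)) ^ (n - k)))"
    unfolding r p by (rule prob_has_pattern[OF q \<theta>(1,2) k JA JH])
  also have "\<dots> \<le> real n ^ k * (exp (r * b * \<sigma>) * (measure_pmf.prob q X ^ card JA *
             exp (- ((1 - \<theta>) * (r * p\<^sup>2 - r\<^sup>2 * p ^ 3) * (real n - k)))))"
    using 1 2 le1 by (intro mult_left_mono mult_mono) auto
  finally show ?thesis .
qed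

text \<open>A Chernoff bound with base 2: the expectation of \<open>2 ^ d\<close> for a degree
  \<open>d\<close> is \<open>(1 + p) ^ (n - 1)\<close>, followed by a union bound over
  vertices.\<close>

lemma prob_degree_le:
  fixes X :: "nat set"
  assumes q: "finite (set_pmf q)"
  defines "p \<equiv> measure_pmf.prob q X"
  shows "measure_pmf.prob (edge_marks n q)
           {f. \<exists>w<n. \<Delta> < real (card {t. {w, t} \<in> marked n X f})}
         \<le> n * exp (n * p - ln 2 * \<Delta>)"
proof -
  let ?M = "edge_marks n q"
  let ?d = "\<lambda>w f. card {t. {w, t} \<in> marked n X f}"
  have one: "measure_pmf.prob ?M {f. \<Delta> < real (?d w f)} \<le> exp (n * p - ln 2 * \<Delta>)" if w: "w < n" for w
  proof -
    let ?F = "\<lambda>t f. 1 + of_bool (f {w, t} \<in> X) :: real"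
    have d: "2 ^ ?d w f = (\<Prod>t\<in>{..<n} - {w}. ?F t f)" for f
    proof -
      have "{t. {w, t} \<in> marked n X f} = {t \<in> {..<n} - {w}. f {w, t} \<in> X}"
        using w by (auto simp: marked_def)
      moreover have "(\<Prod>t\<in>T. ?F t f) = 2 ^ card {t \<in> T. f {w, t} \<in> X}" if "finite T" for T
        using that
      proof (induction T rule: finite_induct)
        case (insert t T)
        have "{s \<in> insert t T. f {w, s} \<in> X} =
          (if f {w, t} \<in> X then insert t {s \<in> T. f {w, s} \<in> X} else {s \<in> T. f {w, s} \<in> X})" by auto
        then show ?case using insert by simp
      qed simp
      ultimately show ?thesis by simp
    qed
    have "measure_pmf.expectation ?M (\<lambda>f. 2 ^ ?d w f) = (\<Prod>t\<in>{..<n} - {w}. measure_pmf.expectation ?M (?F t))"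
      unfolding d edge_marks_def
      by (rule expectation_Pi_pmf_prod[where A = "\<lambda>t. {{w, t}}"])
        (use q in \<open>auto simp: depends_only_def disjoint_family_on_def doubleton_eq_iff\<close>)
    also have "\<dots> = (\<Prod>t\<in>{..<n} - {w}. 1 + p)"
    proof (rule prod.cong[OF refl])
      fix t assume "t \<in> {..<n} - {w}"
      then have "{{w, t}} \<subseteq> complete_edges n" using w by auto
      from expectation_Pi_pmf_indicators[OF finite_complete_edges q this, of 2 X]
      have "measure_pmf.expectation ?M (\<lambda>f. of_bool (f {w, t} \<in> X)) = p"
        by (simp add: edge_marks_def p_def)
      then show "measure_pmf.expectation ?M (?F t) = 1 + p" using q by simp
    qed
    also have "\<dots> = (1 + p) ^ (n - 1)" using w by simp
    also have "\<dots> \<le> exp p ^ (n - 1)"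
      by (intro power_mono) (auto simp: p_def)
    also have "\<dots> \<le> exp p ^ n" by (intro power_increasing) (auto simp: p_def)
    also have "\<dots> = exp (n * p)" by (simp add: exp_of_nat_mult)
    finally have E: "measure_pmf.expectation ?M (\<lambda>f. 2 ^ ?d w f) \<le> exp (n * p)" .
    have "measure_pmf.prob ?M {f. \<Delta> < real (?d w f)} = measure_pmf.expectation ?M (\<lambda>f. of_bool (\<Delta> < real (?d w f)))"
      by (rule prob_eq_expectation_of_bool)
    also have "\<dots> \<le> measure_pmf.expectation ?M (\<lambda>f. exp (- (ln 2 * \<Delta>)) * 2 ^ ?d w f)"
    proof (rule integral_mono)
      fix f
      have "1 \<le> exp (- (ln 2 * \<Delta>)) * 2 ^ ?d w f" if "\<Delta> < real (?d w f)"
      proof -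
        have "(2::real) ^ ?d w f = exp (ln 2 * real (?d w f))"
          by (metis exp_ln exp_of_nat2_mult zero_less_numeral)
        moreover have "ln 2 * \<Delta> \<le> ln 2 * real (?d w f)"
          using that by (intro mult_left_mono) auto
        ultimately show ?thesis by (simp add: exp_add[symmetric])
      qed
      then show "of_bool (\<Delta> < real (?d w f)) \<le> exp (- (ln 2 * \<Delta>)) * 2 ^ ?d w f"
        by (auto simp: of_bool_def)
    qed (use q in auto)
    also have "\<dots> = exp (- (ln 2 * \<Delta>)) * measure_pmf.expectation ?M (\<lambda>f. 2 ^ ?d w f)" by simp
    also have "\<dots> \<le> exp (- (ln 2 * \<Delta>)) * exp (n * p)" using E by (intro mult_left_mono) auto
    also have "\<dots> = exp (n * p - ln 2 * \<Delta>)" by (simp add: exp_add[symmetric] exp_diff exp_minus field_simps)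
    finally show ?thesis .
  qed
  have "{f. \<exists>w<n. \<Delta> < real (?d w f)} = (\<Union>w\<in>{..<n}. {f. \<Delta> < real (?d w f)})" by auto
  then have "measure_pmf.prob ?M {f. \<exists>w<n. \<Delta> < real (?d w f)}
     \<le> (\<Sum>w\<in>{..<n}. measure_pmf.prob ?M {f. \<Delta> < real (?d w f)})"
    using measure_pmf.finite_measure_subadditive_finite[of "{..<n}" "\<lambda>w. {f. \<Delta> < real (?d w f)}" ?M] by simp
  also have "\<dots> \<le> (\<Sum>w\<in>{..<n}. exp (n * p - ln 2 * \<Delta>))" using one by (intro sum_mono) auto
  finally show ?thesis by simp
qed

section \<open>Second moment of the number of pairs at distance at least three\<close>

text \<open>Chebyshev's inequality for the number of events that occur: if none does, this number
  differs from its mean by the whole mean.\<close>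

lemma prob_sum_indicators_eq_0:
  fixes M :: "'a pmf" and I :: "'i \<Rightarrow> 'a \<Rightarrow> bool" and \<mu> \<beta> :: real
  assumes fin: "finite (set_pmf M)" and H: "finite H" "H \<noteq> {}"
    and E: "\<And>h. h \<in> H \<Longrightarrow> measure_pmf.prob M {x. I h x} = \<mu>" and \<mu>: "0 < \<mu>"
    and E2: "\<And>h h'. h \<in> H \<Longrightarrow> h' \<in> H \<Longrightarrow> h \<noteq> h' \<Longrightarrow> measure_pmf.prob M {x. I h x \<and> I h' x} \<le> \<beta>"
    and \<beta>: "0 \<le> \<beta>"
  shows "measure_pmf.prob M {x. \<forall>h\<in>H. \<not> I h x} \<le> 1 / (card H * \<mu>) + (\<beta> / \<mu>\<^sup>2 - 1)"
proof -
  let ?E = "measure_pmf.expectation M"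
  let ?Y = "\<lambda>x. \<Sum>h\<in>H. of_bool (I h x) :: real"
  let ?m = "real (card H)"
  have [simp]: "integrable (measure_pmf M) g" for g :: "'a \<Rightarrow> real"
    using fin by (intro integrable_measure_pmf_finite)
  have m: "0 < ?m" using H by (simp add: card_gt_0_iff)
  have EY: "?E ?Y = ?m * \<mu>"
    using E by (simp add: prob_eq_expectation_of_bool)
  have "?E (\<lambda>x. (?Y x)\<^sup>2) = (\<Sum>h\<in>H. \<Sum>h'\<in>H. measure_pmf.prob M {x. I h x \<and> I h' x})"
    unfolding prob_eq_expectation_of_bool power2_eq_square sum_product of_bool_conj by simp
  also have "\<dots> \<le> (\<Sum>h\<in>H. \<Sum>h'\<in>H. (if h' = h then \<mu> else 0) + \<beta>)"
  proof (intro sum_mono)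
    fix h h' assume "h \<in> H" "h' \<in> H"
    then show "measure_pmf.prob M {x. I h x \<and> I h' x} \<le> (if h' = h then \<mu> else 0) + \<beta>"
      using E[of h] E2[of h h'] \<beta> by auto
  qed
  also have "\<dots> = ?m * \<mu> + ?m\<^sup>2 * \<beta>"
    using H by (simp add: sum.distrib power2_eq_square algebra_simps)
  finally have EY2: "?E (\<lambda>x. (?Y x)\<^sup>2) \<le> ?m * \<mu> + ?m\<^sup>2 * \<beta>" .
  have "(?m * \<mu>)\<^sup>2 * measure_pmf.prob M {x. \<forall>h\<in>H. \<not> I h x} =
        ?E (\<lambda>x. (?m * \<mu>)\<^sup>2 * of_bool (\<forall>h\<in>H. \<not> I h x))"
    by (simp add: prob_eq_expectation_of_bool del: of_bool_not_iff)
  also have "\<dots> \<le> ?E (\<lambda>x. (?Y x - ?m * \<mu>)\<^sup>2)"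
  proof (rule integral_mono)
    fix x
    have "(?Y x - ?m * \<mu>)\<^sup>2 = (?m * \<mu>)\<^sup>2" if "\<forall>h\<in>H. \<not> I h x"
      using that by simp
    then show "(?m * \<mu>)\<^sup>2 * of_bool (\<forall>h\<in>H. \<not> I h x) \<le> (?Y x - ?m * \<mu>)\<^sup>2"
      by (cases "\<forall>h\<in>H. \<not> I h x") auto
  qed auto
  also have "\<dots> = ?E (\<lambda>x. (?Y x)\<^sup>2 - 2 * (?m * \<mu>) * ?Y x + (?m * \<mu>)\<^sup>2)"
    by (simp add: power2_diff algebra_simps)
  also have "\<dots> = ?E (\<lambda>x. (?Y x)\<^sup>2) - 2 * (?m * \<mu>) * ?E ?Y + (?m * \<mu>)\<^sup>2"
    by (subst Bochner_Integration.integral_add, simp, simp, subst Bochner_Integration.integral_diff) auto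
  also have "\<dots> = ?E (\<lambda>x. (?Y x)\<^sup>2) - (?m * \<mu>)\<^sup>2" unfolding EY by (simp add: power2_eq_square)
  also have "\<dots> \<le> ?m * \<mu> + ?m\<^sup>2 * \<beta> - (?m * \<mu>)\<^sup>2" using EY2 by simp
  finally have *: "(?m * \<mu>)\<^sup>2 * measure_pmf.prob M {x. \<forall>h\<in>H. \<not> I h x} \<le> ?m * \<mu> + ?m\<^sup>2 * \<beta> - (?m * \<mu>)\<^sup>2" .
  have "measure_pmf.prob M {x. \<forall>h\<in>H. \<not> I h x} \<le> (?m * \<mu> + ?m\<^sup>2 * \<beta> - (?m * \<mu>)\<^sup>2) / (?m * \<mu>)\<^sup>2"
    using * m \<mu> by (subst pos_le_divide_eq) (auto simp: mult.commute)
  also have "\<dots> = 1 / (?m * \<mu>) + (\<beta> / \<mu>\<^sup>2 - 1)"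
    using m \<mu> by (simp add: field_simps power2_eq_square)
  finally show ?thesis .
qed

definition far :: "nat set set \<Rightarrow> nat set \<Rightarrow> bool" where
  "far G h \<longleftrightarrow> h \<notin> G \<and> common_nbrs G h = {}"

lemma prob_far:
  fixes Y :: "nat set"
  assumes q: "finite (set_pmf q)" and h: "h \<in> complete_edges n"
  defines "p \<equiv> measure_pmf.prob q Y"
  shows "measure_pmf.prob (edge_marks n q) {f. far (marked n Y f) h} = (1 - p) * (1 - p\<^sup>2) ^ (n - 2)"
proof -
  let ?E = "measure_pmf.expectation (edge_marks n q)"
  let ?J = "\<lambda>z f. z \<in> common_nbrs (marked n Y f) h"
  have h2: "h \<subseteq> {..<n}" "card h = 2" "finite h" "h \<noteq> {}"
    using h finite_subset by (auto simp: complete_edges_def)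
  have eq: "of_bool (far (marked n Y f) h) =
     (\<Prod>e\<in>{h}. of_bool (f e \<in> - Y)) * (\<Prod>z\<in>{..<n} - h. of_bool (\<not> ?J z f) :: real)" for f
  proof -
    have prd: "(\<Prod>z\<in>Z. of_bool (P z) :: real) = of_bool (\<forall>z\<in>Z. P z)" if "finite Z" for Z :: "nat set" and P
      using that by (induction Z rule: finite_induct) auto
    have cn: "common_nbrs (marked n Y f) h \<subseteq> {..<n} - h"
    proof
      fix z assume z: "z \<in> common_nbrs (marked n Y f) h"
      then have "{z, s} \<in> complete_edges n" if "s \<in> h" for s
        using z that marked_subset[of n Y f] unfolding common_nbrs_def by blast
      then show "z \<in> {..<n} - h" using h2(4) by fastforce
    qed
    have "far (marked n Y f) h \<longleftrightarrow> f h \<in> - Y \<and> (\<forall>z\<in>{..<n} - h. \<not> ?J z f)"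
      using cn h unfolding far_def by (auto simp: marked_def)
    then show ?thesis by (simp only: prd finite_Diff finite_lessThan of_bool_conj) simp
  qed
  have "measure_pmf.prob (edge_marks n q) {f. far (marked n Y f) h} =
        ?E (\<lambda>f. (\<Prod>e\<in>{h}. of_bool (f e \<in> - Y)) * (\<Prod>z\<in>{..<n} - h. of_bool (\<not> ?J z f)))"
    unfolding prob_eq_expectation_of_bool eq ..
  also have "\<dots> = ?E (\<lambda>f. \<Prod>e\<in>{h}. of_bool (f e \<in> - Y)) * ?E (\<lambda>f. \<Prod>z\<in>{..<n} - h. of_bool (\<not> ?J z f))"
    unfolding edge_marks_def
  proof (rule expectation_Pi_pmf_mult[OF finite_complete_edges q])
    show "depends_only {h} (\<lambda>f. \<Prod>e\<in>{h}. of_bool (f e \<in> - Y) :: real)"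
      by (simp add: depends_only_def)
    show "depends_only (\<Union>z\<in>{..<n} - h. (\<lambda>s. {z, s}) ` h) (\<lambda>f. \<Prod>z\<in>{..<n} - h. of_bool (\<not> ?J z f) :: real)"
      by (intro depends_only_prod depends_only_comp[OF depends_only_common_nbrs, where g = "\<lambda>b. of_bool (\<not> b)"]) auto
    show "{h} \<inter> (\<Union>z\<in>{..<n} - h. (\<lambda>s. {z, s}) ` h) = {}" by auto
  qed
  also have "?E (\<lambda>f. \<Prod>e\<in>{h}. of_bool (f e \<in> - Y)) = 1 - p"
    using expectation_Pi_pmf_indicators[OF finite_complete_edges q, of "{h}" n 2 "- Y"] h
      measure_pmf.prob_compl[of Y q]
    by (simp add: edge_marks_def p_def Compl_eq_Diff_UNIV)
  also have "?E (\<lambda>f. \<Prod>z\<in>{..<n} - h. of_bool (\<not> ?J z f)) = (\<Prod>z\<in>{..<n} - h. ?E (\<lambda>f. of_bool (\<not> ?J z f) :: real))"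
    unfolding edge_marks_def
  proof (rule expectation_Pi_pmf_prod[OF finite_complete_edges q])
    show "disjoint_family_on (\<lambda>z. (\<lambda>s. {z, s}) ` h) ({..<n} - h)"
      by (auto simp: disjoint_family_on_def doubleton_eq_iff)
    show "depends_only ((\<lambda>s. {z, s}) ` h) (\<lambda>f. of_bool (\<not> ?J z f) :: real)" for z
      by (rule depends_only_comp[OF depends_only_common_nbrs, where g = "\<lambda>b. of_bool (\<not> b)"]) auto
  qed auto
  also have "\<dots> = (\<Prod>z\<in>{..<n} - h. 1 - p\<^sup>2)"
  proof (rule prod.cong[OF refl])
    fix z assume "z \<in> {..<n} - h"
    then have "?E (\<lambda>f. of_bool (?J z f)) = p\<^sup>2"
      using expectation_common_nbrs[OF q, of z n h Y] h2 by (simp add: p_def)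
    then show "?E (\<lambda>f. of_bool (\<not> ?J z f)) = 1 - p\<^sup>2"
      unfolding of_bool_not_iff using q by simp
  qed
  also have "\<dots> = (1 - p\<^sup>2) ^ (n - 2)" using h2 by (simp add: card_Diff_subset)
  finally show ?thesis .
qed

text \<open>The instance \<open>\<theta> = 0\<close> of \<open>expectation_pattern\<close> without
  prescribed edges. It covers disjoint pairs and pairs with a common vertex alike; only the missing
  common neighbours outside the two pairs are charged for.\<close>

lemma prob_two_far:
  fixes Y :: "nat set"
  assumes q: "finite (set_pmf q)" and h: "h \<in> complete_edges n" "h' \<in> complete_edges n" "h \<noteq> h'"
  defines "p \<equiv> measure_pmf.prob q Y"
  assumes p: "p \<le> 1 / 2"
  shows "measure_pmf.prob (edge_marks n q) {f. far (marked n Y f) h \<and> far (marked n Y f) h'}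
     \<le> (1 - (2 * p\<^sup>2 - 4 * p ^ 3)) ^ (n - 4)"
proof -
  let ?E = "measure_pmf.expectation (edge_marks n q)"
  let ?H = "{h, h'}" and ?S = "h \<union> h'"
  have h2: "h \<subseteq> {..<n}" "card h = 2" "h' \<subseteq> {..<n}" "card h' = 2"
    using h by (auto simp: complete_edges_def)
  have p0: "0 \<le> p" by (simp add: p_def)
  have "measure_pmf.prob (edge_marks n q) {f. far (marked n Y f) h \<and> far (marked n Y f) h'}
     \<le> ?E (\<lambda>f. of_bool ({} \<subseteq> marked n Y f) *
        (\<Prod>z\<in>{..<n} - ?S. 0 ^ card {h\<in>?H. z \<in> common_nbrs (marked n Y f) h}))"
    unfolding prob_eq_expectation_of_bool
  proof (rule integral_mono)
    fix f
    have "(\<Prod>z\<in>{..<n} - ?S. 0 ^ card {h\<in>?H. z \<in> common_nbrs (marked n Y f) h}) = (1 :: real)"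
      if "far (marked n Y f) h" "far (marked n Y f) h'"
    proof (rule prod.neutral, rule ballI)
      fix z
      have "{h\<in>?H. z \<in> common_nbrs (marked n Y f) h} = {}"
        using that by (auto simp: far_def)
      then show "0 ^ card {h\<in>?H. z \<in> common_nbrs (marked n Y f) h} = (1 :: real)" by (simp only: card.empty power_0)
    qed
    then show "of_bool (far (marked n Y f) h \<and> far (marked n Y f) h') \<le>
      of_bool ({} \<subseteq> marked n Y f) * (\<Prod>z\<in>{..<n} - ?S. 0 ^ card {h\<in>?H. z \<in> common_nbrs (marked n Y f) h} :: real)"
      by (cases "far (marked n Y f) h \<and> far (marked n Y f) h'") (auto intro!: prod_nonneg)
  qed (use q in auto)
  also have "\<dots> \<le> measure_pmf.prob q Y ^ card ({} :: nat set set) *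
            (1 - (1 - 0) * (real (card ?H) * p\<^sup>2 - (real (card ?H))\<^sup>2 * p ^ 3)) ^ (n - card ?S)"
    unfolding p_def by (rule expectation_pattern[OF q]) (use h2 in auto)
  also have "\<dots> = (1 - (2 * p\<^sup>2 - 4 * p ^ 3)) ^ (n - card ?S)" using h(3) by simp
  also have "\<dots> \<le> (1 - (2 * p\<^sup>2 - 4 * p ^ 3)) ^ (n - 4)"
  proof (rule power_decreasing)
    have "card ?S \<le> 4" using card_Un_le[of h h'] h2 by simp
    then show "n - 4 \<le> n - card ?S" by simp
    have "p\<^sup>2 * (2 * p) \<le> p\<^sup>2 * 1" using p by (intro mult_left_mono) auto
    then show "1 - (2 * p\<^sup>2 - 4 * p ^ 3) \<le> 1" by (simp add: power2_eq_square power3_eq_cube mult_ac)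
    have "p\<^sup>2 \<le> (1 / 2)\<^sup>2" using p p0 by (intro power_mono) auto
    then have "2 * p\<^sup>2 \<le> 1" by (simp add: power2_eq_square)
    then show "0 \<le> 1 - (2 * p\<^sup>2 - 4 * p ^ 3)" using p0 zero_le_power[OF p0, of 3] by linarith
  qed
  finally show ?thesis .
qed

text \<open>\<open>\<nu>\<close> is the probability of a far pair with the exponent
  \<open>n - 2\<close> raised to \<open>n\<close>, a lower bound in exponential form that is easier
  to expand.\<close>

lemma prob_diam_le_2:
  fixes Y :: "nat set"
  assumes q: "finite (set_pmf q)" and n: "4 \<le> n"
  defines "p \<equiv> measure_pmf.prob q Y"
  assumes p: "p \<le> 1 / 2"
  defines "\<nu> \<equiv> (1 - p) * exp (n * ln (1 - p\<^sup>2))"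
  shows "measure_pmf.prob (edge_marks n q) {f. diam_le_2 n (marked n Y f)}
     \<le> 1 / (real n * (real n - 1) / 2 * \<nu>) + (exp (- ((2 * p\<^sup>2 - 4 * p ^ 3) * (real n - 4))) / \<nu>\<^sup>2 - 1)"
proof -
  let ?H = "complete_edges n"
  let ?\<mu> = "(1 - p) * (1 - p\<^sup>2) ^ (n - 2)" and ?\<beta> = "(1 - (2 * p\<^sup>2 - 4 * p ^ 3)) ^ (n - 4)"
  have p0: "0 \<le> p" by (simp add: p_def)
  have p2: "p\<^sup>2 \<le> 1 / 4" using power_mono[OF p p0, of 2] by (simp add: power2_eq_square)
  have le1: "2 * p\<^sup>2 - 4 * p ^ 3 \<le> 1" using p2 zero_le_power[OF p0, of 3] by linarith
  have \<nu>: "0 < \<nu>" using p by (simp add: \<nu>_def)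
  have \<nu>\<mu>: "\<nu> \<le> ?\<mu>"
  proof -
    have "exp (n * ln (1 - p\<^sup>2)) = (1 - p\<^sup>2) ^ n"
      using p2 by (simp add: exp_of_nat_mult)
    also have "\<dots> \<le> (1 - p\<^sup>2) ^ (n - 2)"
      using p2 by (intro power_decreasing) auto
    finally show ?thesis unfolding \<nu>_def using p by (intro mult_left_mono) auto
  qed
  have cH: "real (card ?H) = real n * (real n - 1) / 2"
  proof -
    have "real (card ?H) = real (n * (n - 1) div 2)" unfolding card_complete_edges choose_two ..
    moreover have "even (n * (n - 1))" by (cases n) auto
    then have "real (n * (n - 1) div 2) = real (n * (n - 1)) / 2" by (simp add: real_of_nat_div)
    ultimately show ?thesis using n by (simp add: of_nat_diff)
  qed
  have m: "0 < real n * (real n - 1) / 2" using n by simp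
  then have ne: "?H \<noteq> {}" using cH by auto
  have "measure_pmf.prob (edge_marks n q) {f. diam_le_2 n (marked n Y f)}
     = measure_pmf.prob (edge_marks n q) {f. \<forall>h\<in>?H. \<not> far (marked n Y f) h}"
    unfolding diam_le_2_def far_def by (intro arg_cong[where f = "measure_pmf.prob _"]) auto
  also have "\<dots> \<le> 1 / (card ?H * ?\<mu>) + (?\<beta> / ?\<mu>\<^sup>2 - 1)"
  proof (rule prob_sum_indicators_eq_0)
    show "finite (set_pmf (edge_marks n q))" by (rule finite_set_edge_marks[OF q])
    show "0 < ?\<mu>" using \<nu>\<mu> \<nu> by linarith
    show "0 \<le> ?\<beta>" using le1 by simp
  qed (use q ne p prob_far prob_two_far in \<open>auto simp: p_def\<close>)
  also have "\<dots> \<le> 1 / (card ?H * \<nu>) + (exp (- ((2 * p\<^sup>2 - 4 * p ^ 3) * (real n - 4))) / \<nu>\<^sup>2 - 1)"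
  proof (intro add_mono diff_right_mono frac_le mult_left_mono power_mono)
    show "?\<beta> \<le> exp (- ((2 * p\<^sup>2 - 4 * p ^ 3) * (real n - 4)))"
      using one_minus_power_le_exp[OF le1, of "n - 4"] n by (simp add: of_nat_diff)
  qed (use \<nu> \<nu>\<mu> m cH in auto)
  finally show ?thesis unfolding cH .
qed

section \<open>From missing patterns to equal hitting times\<close>

text \<open>A violated condition shows up as a configuration of bounded size: two low pairs with a
  common vertex, joined by an edge, or with a common middle, or a fixed number of weak pairs at
  \<open>s\<close> whose other ends are adjacent to \<open>w\<close>.\<close>

lemma sparse_pairI:
  fixes lo hi \<Delta> :: real
  assumes G01: "G0 \<subseteq> G1" and G1: "G1 \<subseteq> complete_edges n"
    and P3: "\<not> has_pattern n 3 {} {(0, 1), (0, 2)} lo G1 G0"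
    and P4: "\<not> has_pattern n 4 {(0, 2)} {(0, 1), (2, 3)} lo G1 G0"
    and P5: "\<not> has_pattern n 5 {(0, 4), (1, 4), (2, 4), (3, 4)} {(0, 1), (2, 3)} lo G1 G0"
    and PC: "\<not> has_pattern n (C + 2) ((\<lambda>i. (1, i)) ` {2..<C + 2}) ((\<lambda>i. (0, i)) ` {2..<C + 2}) hi G1 G0"
    and deg: "\<And>w. w < n \<Longrightarrow> card {t. {w, t} \<in> G1} \<le> \<Delta>"
    and k: "0 < k0" "k0 + 6 \<le> lo" "k0 \<le> k1" "k1 + 6 \<le> hi"
    and small: "4 * k1 * (C / 2 ^ k0 + \<Delta> / 2 ^ k1) \<le> 1 / 4"
  shows "sparse_pair n G0 G1 lo hi \<Delta> C k0 k1"
proof -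
  have pair: "\<exists>u. h = {s, u} \<and> s \<noteq> u \<and> u < n \<and> s < n" if "h \<in> complete_edges n" "s \<in> h" for h s
    using that by (elim complete_edgesE) auto
  have disj: "h = h'" if h: "h \<in> complete_edges n" "h' \<in> complete_edges n"
    and low: "card (common_nbrs G0 h) < lo" "card (common_nbrs G0 h') < lo" and s: "s \<in> h" "s \<in> h'" for h h' s
  proof (rule ccontr)
    assume ne: "h \<noteq> h'"
    obtain u v where uv: "h = {s, u}" "h' = {s, v}" "s \<noteq> u" "s \<noteq> v" "u < n" "v < n" "s < n"
      using pair[OF h(1) s(1)] pair[OF h(2) s(2)] by auto
    then have "has_pattern n 3 {} {(0, 1), (0, 2)} lo G1 G0"
      unfolding has_pattern_def using low ne by (intro exI[of _ "[s, u, v]"]) auto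
    then show False using P3 by blast
  qed
  \<comment> \<open>Low pairs are already known to be disjoint, so two of them span four vertices;
    the chosen ends come to positions 0 and 2, where the four-vertex pattern expects its
    edge.\<close>
  have four: "\<exists>u v. h = {s, u} \<and> h' = {s', v} \<and> distinct [s, u, s', v] \<and> set [s, u, s', v] \<subseteq> {..<n}"
    if h: "h \<in> complete_edges n" "h' \<in> complete_edges n"
    and low: "card (common_nbrs G0 h) < lo" "card (common_nbrs G0 h') < lo" and ne: "h \<noteq> h'"
    and s: "s \<in> h" "s' \<in> h'" for h h' s s'
  proof -
    obtain u v where uv: "h = {s, u}" "h' = {s', v}" "s \<noteq> u" "s' \<noteq> v" "u < n" "v < n" "s < n" "s' < n"
      using pair[OF h(1) s(1)] pair[OF h(2) s(2)] by auto
    have "h \<inter> h' = {}" using disj[OF h low] ne by blast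
    then show ?thesis using uv by auto
  qed
  show ?thesis
  proof (unfold_locales; (fact G01 G1 deg k small)?)
    show "h = h'" if "h \<in> complete_edges n" "h' \<in> complete_edges n"
      "card (common_nbrs G0 h) < lo" "card (common_nbrs G0 h') < lo" "s \<in> h" "s \<in> h'" for h h' s
      using that by (rule disj)
    show "{s, s'} \<notin> G1" if h: "h \<in> complete_edges n" "h' \<in> complete_edges n"
      and low: "card (common_nbrs G0 h) < lo" "card (common_nbrs G0 h') < lo" and ne: "h \<noteq> h'"
      and s: "s \<in> h" "s' \<in> h'" for h h' s s'
    proof
      assume e: "{s, s'} \<in> G1"
      obtain u v where uv: "h = {s, u}" "h' = {s', v}" "distinct [s, u, s', v]" "set [s, u, s', v] \<subseteq> {..<n}"
        using four[OF h low ne s] by blast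
      have "has_pattern n 4 {(0, 2)} {(0, 1), (2, 3)} lo G1 G0"
        unfolding has_pattern_def using low e uv by (intro exI[of _ "[s, u, s', v]"]) (auto simp: numeral_eq_Suc)
      then show False using P4 by blast
    qed
    show "h = h'" if h: "h \<in> complete_edges n" "h' \<in> complete_edges n"
      and low: "card (common_nbrs G0 h) < lo" "card (common_nbrs G0 h') < lo"
      and y: "y \<in> common_nbrs G1 h" "y \<in> common_nbrs G1 h'" for h h' y
    proof (rule ccontr)
      assume ne: "h \<noteq> h'"
      obtain s s' where s: "s \<in> h" "s' \<in> h'" using h by (metis complete_edgesE insertI1)
      obtain u v where uv: "h = {s, u}" "h' = {s', v}" "distinct [s, u, s', v]" "set [s, u, s', v] \<subseteq> {..<n}"
        using four[OF h low ne s] by blast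
      have e: "{y, s} \<in> G1" "{y, u} \<in> G1" "{y, s'} \<in> G1" "{y, v} \<in> G1"
        using y uv by (auto simp: common_nbrs_pair)
      then have "y < n \<and> y \<noteq> s \<and> y \<noteq> u \<and> y \<noteq> s' \<and> y \<noteq> v"
        using subsetD[OF G1 e(1)] subsetD[OF G1 e(2)] subsetD[OF G1 e(3)] subsetD[OF G1 e(4)] by auto
      then have "has_pattern n 5 {(0, 4), (1, 4), (2, 4), (3, 4)} {(0, 1), (2, 3)} lo G1 G0"
        unfolding has_pattern_def using low e uv
        by (intro exI[of _ "[s, u, s', v, y]"]) (auto simp: numeral_eq_Suc insert_commute)
      then show False using P5 by blast
    qed
    show "card {t. t \<noteq> s \<and> {w, t} \<in> G1 \<and> card (common_nbrs G0 {s, t}) < hi} \<le> C"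
      if sw: "s < n" "w < n" "s \<noteq> w" for s w
    proof (rule ccontr)
      let ?T = "{t. t \<noteq> s \<and> {w, t} \<in> G1 \<and> card (common_nbrs G0 {s, t}) < hi}"
      assume "\<not> card ?T \<le> C"
      then obtain T where T: "T \<subseteq> ?T" "card T = C" "finite T"
        by (meson nat_le_linear obtain_subset_with_card_n)
      obtain ts where ts: "set ts = T" "distinct ts" "length ts = C"
        using finite_distinct_list[OF T(3)] T(2) distinct_card by metis
      have tn: "t < n \<and> t \<noteq> w \<and> t \<noteq> s" if "t \<in> T" for t
      proof -
        have t: "t \<noteq> s" "{w, t} \<in> G1" using subsetD[OF T(1) that] by auto
        show ?thesis using t(1) subsetD[OF G1 t(2)] by auto
      qed
      have nth: "(s # w # ts) ! i \<in> T" if "i \<in> {2..<C + 2}" for i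
      proof -
        have "(s # w # ts) ! i = ts ! (i - 2)" "i - 2 < length ts"
          using that ts by (auto simp: nth_Cons' numeral_2_eq_2)
        then show ?thesis using ts(1) nth_mem by metis
      qed
      have "has_pattern n (C + 2) ((\<lambda>i. (1, i)) ` {2..<C + 2}) ((\<lambda>i. (0, i)) ` {2..<C + 2}) hi G1 G0"
        unfolding has_pattern_def
      proof (intro exI[of _ "s # w # ts"] conjI)
        show "distinct (s # w # ts)" "set (s # w # ts) \<subseteq> {..<n}"
          using ts sw tn by auto
        show "\<forall>(i, j)\<in>(\<lambda>i. (1, i)) ` {2..<C + 2}. {(s # w # ts) ! i, (s # w # ts) ! j} \<in> G1"
          using subsetD[OF T(1) nth] by fastforce
        show "\<forall>(i, j)\<in>(\<lambda>i. (0, i)) ` {2..<C + 2}. card (common_nbrs G0 {(s # w # ts) ! i, (s # w # ts) ! j}) < hi"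
          using subsetD[OF T(1) nth] by fastforce
      qed (use ts in auto)
      then show False using PC by blast
    qed
  qed (use k small in simp_all)
qed

text \<open>A count below 1 encodes an empty common neighbourhood. The pattern is absent above the
  threshold even for adjacent pairs.\<close>

lemma diam_le_2_if_no_pattern:
  assumes G: "G \<subseteq> complete_edges n" and "\<not> has_pattern n 2 {} {(0, 1)} 1 G G"
  shows "diam_le_2 n G"
  unfolding diam_le_2_def
proof
  fix h assume h: "h \<in> complete_edges n"
  then obtain u v where uv: "h = {u, v}" "u < n" "v < n" "u \<noteq> v" by (rule complete_edgesE)
  have "common_nbrs G h \<noteq> {}"
  proof
    assume "common_nbrs G h = {}"
    then have "has_pattern n 2 {} {(0, 1)} 1 G G"
      unfolding has_pattern_def using uv by (intro exI[of _ "[u, v]"]) auto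
    then show False using assms by blast
  qed
  then show "h \<in> G \<or> common_nbrs G h \<noteq> {}" ..
qed

lemma graph_at_mono: "s \<le> t \<Longrightarrow> graph_at es s \<subseteq> graph_at es t"
  unfolding graph_at_def by (rule set_take_subset_set_take)

text \<open>Diameter two is monotone in the graph, so it is first reached between the two given
  graphs, where it already yields a rainbow colouring.\<close>

lemma diam_time_eq_rainbow_time:
  assumes es: "es \<in> permutations_of_set (complete_edges n)"
    and sp: "sparse_pair n (graph_at es s) (graph_at es t) lo hi \<Delta> C k0 k1"
    and s: "\<not> diam_le_2 n (graph_at es s)" and t: "diam_le_2 n (graph_at es t)"
  shows "diam_time n es = rainbow_time n es"
proof -
  have sub: "graph_at es i \<subseteq> complete_edges n" for i
    using es set_take_subset[of i es] by (auto simp: graph_at_def permutations_of_set_def)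
  let ?d = "diam_time n es"
  have d: "?d = (LEAST i. diam_le_2 n (graph_at es i))"
    unfolding diam_time_def graph_diam_le_2_iff[OF sub] ..
  have dd: "diam_le_2 n (graph_at es ?d)"
    unfolding d by (rule LeastI[of "\<lambda>i. diam_le_2 n (graph_at es i)", OF t])
  have d_le: "?d \<le> i" if "diam_le_2 n (graph_at es i)" for i
    unfolding d by (rule Least_le[of "\<lambda>i. diam_le_2 n (graph_at es i)", OF that])
  have "?d \<le> t" by (rule d_le[OF t])
  have "s \<le> ?d"
  proof (rule ccontr)
    assume "\<not> s \<le> ?d"
    then have "graph_at es ?d \<subseteq> graph_at es s" by (intro graph_at_mono) auto
    then show False using diam_le_2_mono[OF dd] s by blast
  qed
  have rc: "rainbow_connection_number {..<n} (graph_at es ?d) \<le> 2"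
    using \<open>s \<le> ?d\<close> \<open>?d \<le> t\<close> dd by (intro sparse_pair.rainbow_if_diam[OF sp] graph_at_mono)
  show ?thesis
  proof (rule antisym)
    have "rainbow_connection_number {..<n} (graph_at es (rainbow_time n es)) \<le> 2"
      unfolding rainbow_time_def by (rule LeastI[of _ ?d]) (rule rc)
    then have "diam_le_2 n (graph_at es (rainbow_time n es))"
      by (rule rainbow_connection_number_le_2D[OF sub])
    then show "?d \<le> rainbow_time n es" by (rule d_le)
    show "rainbow_time n es \<le> ?d"
      unfolding rainbow_time_def by (rule Least_le) (rule rc)
  qed
qed

section \<open>Asymptotics\<close>

lemma exp_1_ge: "exp (1 :: real) \<ge> 27182 / 10000" and exp_1_le: "exp (1 :: real) \<le> 27183 / 10000"
  using e_approx_32 by (simp_all add: abs_if field_simps split: if_splits)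

text \<open>Just precise enough for the local lemma:
  \<open>0.73 * 0.69 = 0.5037 > 1 / 2\<close>.\<close>

lemma ln_2_ge: "69 / 100 \<le> ln (2 :: real)"
proof -
  have "exp (1::real) ^ 69 \<le> (27183 / 10000) ^ 69" by (intro power_mono exp_1_le) auto
  also have "\<dots> \<le> (2::real) ^ 100" by (simp add: field_simps)
  finally have "exp (69/100 :: real) ^ 100 \<le> 2 ^ 100" by (simp add: exp_of_nat_mult[symmetric])
  then have "exp (69/100 :: real) \<le> 2" by (subst (asm) power_mono_iff) auto
  then show ?thesis by (subst ln_ge_iff) auto
qed

lemma exp_minus_1_le: "exp (- 1) \<le> (368 / 1000 :: real)"
  using exp_1_ge by (simp add: exp_minus field_simps)

lemma exp_minus_3_le: "exp (- 3) \<le> (1 / 20 :: real)"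
proof -
  have "exp (1::real) ^ 3 \<ge> (27182 / 10000) ^ 3" by (intro power_mono exp_1_ge) auto
  moreover have "(20::real) \<le> (27182 / 10000) ^ 3" by (simp add: power3_eq_cube)
  ultimately have "exp (3::real) \<ge> 20" by (simp add: exp_of_nat_mult[symmetric])
  then show ?thesis by (simp add: exp_minus field_simps)
qed

lemma pattern_error_tendsto_0:
  fixes a b k :: real
  shows "(\<lambda>n::nat. a * (ln n / n) * k + b * sqrt (ln n / n) ^ 3 * (real n - k)) \<longlonglongrightarrow> 0"
  by real_asymp

lemma ln_powr_mult_powr_tendsto_0:
  fixes a e :: real
  assumes "e < 0"
  shows "(\<lambda>n::nat. ln n powr a * real n powr e) \<longlonglongrightarrow> 0"
  using assms by real_asymp

text \<open>The hypothesis collects the powers of \<open>n\<close>: \<open>k\<close> from the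
  placements, \<open>s\<close> from the Chernoff factor, \<open>- j / 2\<close> from the edges and
  the last term from the missing cherries. Logarithms enter only as a power of \<open>ln n\<close>,
  and the cubic correction vanishes because \<open>n\<close> times the cube of the density
  does.\<close>

lemma pattern_bound_tendsto_0:
  fixes c c' r s \<theta> :: real and j k :: nat
  assumes "k + s - j / 2 - (1 - \<theta>) * r * c\<^sup>2 < 0"
  shows "(\<lambda>n::nat. real n ^ k * (exp (s * ln n) * ((c' * sqrt (ln n / n)) ^ j *
     exp (- ((1 - \<theta>) * (r * (c * sqrt (ln n / n))\<^sup>2 - r\<^sup>2 * (c * sqrt (ln n / n)) ^ 3) * (real n - k)))))) \<longlonglongrightarrow> 0"
proof -
  define e where "e = k + s - j / 2 - (1 - \<theta>) * r * c\<^sup>2"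
  define \<epsilon> where "\<epsilon> n = ((1 - \<theta>) * r * c\<^sup>2) * (ln n / n) * k + ((1 - \<theta>) * r\<^sup>2 * c ^ 3) * sqrt (ln n / n) ^ 3 * (real n - k)" for n :: nat
  have "(\<lambda>n. c' ^ j * (ln (real n) powr (j / 2) * real n powr e) * exp (\<epsilon> n)) \<longlonglongrightarrow> c' ^ j * 0 * exp 0"
    unfolding \<epsilon>_def using assms
    by (intro tendsto_mult tendsto_const tendsto_exp ln_powr_mult_powr_tendsto_0 pattern_error_tendsto_0) (simp add: e_def)
  then have lim: "(\<lambda>n. c' ^ j * (ln (real n) powr (j / 2) * real n powr e) * exp (\<epsilon> n)) \<longlonglongrightarrow> 0" by simp
  show ?thesis
  proof (rule Lim_transform_eventually[OF lim])
    show "\<forall>\<^sub>F n in sequentially. c' ^ j * (ln (real n) powr (j / 2) * real n powr e) * exp (\<epsilon> n) =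
      real n ^ k * (exp (s * ln n) * ((c' * sqrt (ln n / n)) ^ j *
       exp (- ((1 - \<theta>) * (r * (c * sqrt (ln n / n))\<^sup>2 - r\<^sup>2 * (c * sqrt (ln n / n)) ^ 3) * (real n - k)))))"
      using eventually_ge_at_top[of 2]
    proof eventually_elim
      case (elim n)
      then have n: "0 < real n" "0 < ln (real n)" by auto
      let ?x = "sqrt (ln n / n)"
      have x2: "?x\<^sup>2 = ln n / n" using n by simp
      have xj: "?x ^ j = ln (real n) powr (j / 2) * real n powr (- (j / 2))"
      proof -
        have "?x ^ j = ((ln n / n) powr (1 / 2)) powr j"
          using n by (simp add: powr_half_sqrt powr_realpow)
        also have "\<dots> = (ln n / n) powr (j / 2)" using n by (simp add: powr_powr)
        also have "\<dots> = ln (real n) powr (j / 2) * real n powr (- (j / 2))"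
          using n by (simp add: powr_divide powr_minus_divide)
        finally show ?thesis .
      qed
      have "(1 - \<theta>) * (r * (c * ?x)\<^sup>2 - r\<^sup>2 * (c * ?x) ^ 3) * (real n - k)
         = (1 - \<theta>) * r * c\<^sup>2 * ?x\<^sup>2 * real n - ((1 - \<theta>) * r * c\<^sup>2) * ?x\<^sup>2 * k
           - ((1 - \<theta>) * r\<^sup>2 * c ^ 3) * ?x ^ 3 * (real n - k)"
        by (simp add: power_mult_distrib algebra_simps)
      also have "\<dots> = (1 - \<theta>) * r * c\<^sup>2 * ln n - \<epsilon> n"
        unfolding x2 \<epsilon>_def using n by simp
      finally have ex: "exp (- ((1 - \<theta>) * (r * (c * ?x)\<^sup>2 - r\<^sup>2 * (c * ?x) ^ 3) * (real n - k)))
        = real n powr (- ((1 - \<theta>) * r * c\<^sup>2)) * exp (\<epsilon> n)"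
        using n by (simp add: powr_def exp_add[symmetric])
      have "real n ^ k = real n powr k" using n by (simp add: powr_realpow)
      moreover have "exp (s * ln n) = real n powr s" using n by (simp add: powr_def)
      moreover have "real n powr e = real n powr k * real n powr s * real n powr (- (j / 2)) *
          real n powr (- ((1 - \<theta>) * r * c\<^sup>2))"
        by (simp add: powr_add[symmetric] e_def)
      moreover have "(c' * ?x) ^ j = c' ^ j * (ln (real n) powr (j / 2) * real n powr (- (j / 2)))"
        by (simp only: power_mult_distrib xj)
      ultimately show ?case unfolding ex by (simp only: mult_ac)
    qed
  qed
qed

text \<open>The constant part \<open>\<beta>'\<close> of the threshold costs a bounded factor only;
  it allows the threshold 1 in the pattern for diameter two.\<close>

lemma prob_has_pattern_tendsto_0:
  fixes q :: "nat \<Rightarrow> nat pmf" and X Y :: "nat set" and c c' \<beta> \<beta>' \<theta> \<sigma> :: real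
  assumes q: "\<And>n. finite (set_pmf (q n))"
    and Y: "\<forall>\<^sub>F n in sequentially. measure_pmf.prob (q n) Y = c * sqrt (ln n / n)"
    and X: "\<forall>\<^sub>F n in sequentially. measure_pmf.prob (q n) X = c' * sqrt (ln n / n)"
    and \<theta>: "0 < \<theta>" "\<theta> \<le> 1" "exp (- \<sigma>) \<le> \<theta>" and \<beta>: "0 \<le> \<beta>" "0 \<le> \<beta>'"
    and JA: "JA \<subseteq> {(i, j). i < j \<and> j < k}" and JH: "JH \<subseteq> {(i, j). i < j \<and> j < k}"
    and neg: "k + card JH * \<beta> * \<sigma> - card JA / 2 - (1 - \<theta>) * card JH * c\<^sup>2 < 0"
  shows "(\<lambda>n. measure_pmf.prob (edge_marks n (q n))
      {f. has_pattern n k JA JH (\<beta> * ln n + \<beta>') (marked n X f) (marked n Y f)}) \<longlonglongrightarrow> 0"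
proof -
  define r where "r = real (card JH)"
  let ?x = "\<lambda>n::nat. sqrt (ln n / n)"
  let ?B = "\<lambda>n::nat. real n ^ k * (exp ((r * \<beta> * \<sigma>) * ln n) * ((c' * ?x n) ^ card JA *
     exp (- ((1 - \<theta>) * (r * (c * ?x n)\<^sup>2 - r\<^sup>2 * (c * ?x n) ^ 3) * (real n - k)))))"
  have "?B \<longlonglongrightarrow> 0"
    by (rule pattern_bound_tendsto_0) (use neg in \<open>simp add: r_def\<close>)
  then have lim: "(\<lambda>n. exp (r * \<beta>' * \<sigma>) * ?B n) \<longlonglongrightarrow> 0"
    by (rule tendsto_mult_right_zero)
  have "(\<lambda>n::nat. (1 - \<theta>) * (r * (c * ?x n)\<^sup>2 - r\<^sup>2 * (c * ?x n) ^ 3)) \<longlonglongrightarrow> 0"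
  proof -
    have "?x \<longlonglongrightarrow> 0" by real_asymp
    then have "(\<lambda>n. (1 - \<theta>) * (r * (c * ?x n)\<^sup>2 - r\<^sup>2 * (c * ?x n) ^ 3)) \<longlonglongrightarrow>
        (1 - \<theta>) * (r * (c * 0)\<^sup>2 - r\<^sup>2 * (c * 0) ^ 3)"
      by (intro tendsto_intros)
    then show ?thesis by simp
  qed
  then have le1: "\<forall>\<^sub>F n in sequentially. (1 - \<theta>) * (r * (c * ?x n)\<^sup>2 - r\<^sup>2 * (c * ?x n) ^ 3) < 1"
    by (rule order_tendstoD) simp
  show ?thesis
  proof (rule tendsto_sandwich[OF _ _ tendsto_const lim])
    show "\<forall>\<^sub>F n in sequentially. measure_pmf.prob (edge_marks n (q n))
      {f. has_pattern n k JA JH (\<beta> * ln n + \<beta>') (marked n X f) (marked n Y f)} \<le> exp (r * \<beta>' * \<sigma>) * ?B n"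
      using X Y le1 eventually_ge_at_top[of "max 1 k"]
    proof eventually_elim
      case (elim n)
      have "0 \<le> \<beta> * ln n + \<beta>'" using \<beta> elim(4) by (intro add_nonneg_nonneg mult_nonneg_nonneg) auto
      from prob_has_pattern_le[OF q[of n] _ \<theta> this JA JH r_def refl, where n = n and X = X and Y = Y]
      have "measure_pmf.prob (edge_marks n (q n))
         {f. has_pattern n k JA JH (\<beta> * ln n + \<beta>') (marked n X f) (marked n Y f)}
         \<le> real n ^ k * (exp (r * (\<beta> * ln n + \<beta>') * \<sigma>) * ((c' * ?x n) ^ card JA *
             exp (- ((1 - \<theta>) * (r * (c * ?x n)\<^sup>2 - r\<^sup>2 * (c * ?x n) ^ 3) * (real n - k)))))"
        using elim by simp
      also have "exp (r * (\<beta> * ln n + \<beta>') * \<sigma>) = exp (r * \<beta>' * \<sigma>) * exp ((r * \<beta> * \<sigma>) * ln n)"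
        by (simp add: exp_add[symmetric] algebra_simps)
      finally show ?case by (simp only: mult_ac)
    qed
  qed simp
qed

section \<open>The law of a mark and the limits of the remaining errors\<close>

definition mark_pmf :: "real \<Rightarrow> real \<Rightarrow> nat pmf" where
  \<comment> \<open>The first coin decides membership in the larger graph, the second thins it to
    the smaller one.\<close>
  "mark_pmf p r = map_pmf (\<lambda>(a, b). if a then if b then 0 else 1 else 2)
     (pair_pmf (bernoulli_pmf p) (bernoulli_pmf r))"

lemma finite_set_mark_pmf [simp]: "finite (set_pmf (mark_pmf p r))"
  unfolding mark_pmf_def set_map_pmf by (rule finite_imageI, rule finite_subset[OF subset_UNIV]) simp

lemma prob_mark_pmf:
  assumes "0 \<le> p" "p \<le> 1" "0 \<le> r" "r \<le> 1"
  shows "measure_pmf.prob (mark_pmf p r) {..0} = p * r" "measure_pmf.prob (mark_pmf p r) {..1} = p"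
proof -
  let ?P = "pair_pmf (bernoulli_pmf p) (bernoulli_pmf r)"
  have "measure_pmf.prob (mark_pmf p r) {..0} = measure_pmf.prob ?P ({True} \<times> {True})"
    unfolding mark_pmf_def measure_map_pmf
    by (intro arg_cong[where f = "measure_pmf.prob ?P"]) (auto split: if_splits)
  also have "\<dots> = p * r" using assms by (subst measure_pmf_prob_product) (auto simp: measure_pmf_single)
  finally show "measure_pmf.prob (mark_pmf p r) {..0} = p * r" .
  have "measure_pmf.prob (mark_pmf p r) {..1} = measure_pmf.prob ?P ({True} \<times> UNIV)"
    unfolding mark_pmf_def measure_map_pmf
    by (intro arg_cong[where f = "measure_pmf.prob ?P"]) (auto split: if_splits)
  also have "\<dots> = p" using assms by (subst measure_pmf_prob_product) (auto simp: measure_pmf_single)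
  finally show "measure_pmf.prob (mark_pmf p r) {..1} = p" .
qed

text \<open>As \<open>1.41^2 = 1.9881 < 2\<close>, the expected number of far pairs grows like
  \<open>n powr 0.0119\<close>, and distinct far pairs are asymptotically uncorrelated.\<close>

lemma prob_diam_le_2_tendsto_0:
  fixes q :: "nat \<Rightarrow> nat pmf" and Y :: "nat set"
  assumes q: "\<And>n. finite (set_pmf (q n))"
    and Y: "\<forall>\<^sub>F n in sequentially. measure_pmf.prob (q n) Y = 141 / 100 * sqrt (ln n / n)"
  shows "(\<lambda>n. measure_pmf.prob (edge_marks n (q n)) {f. diam_le_2 n (marked n Y f)}) \<longlonglongrightarrow> 0"
proof -
  define p where "p n = 141 / 100 * sqrt (ln n / n)" for n :: nat
  \<comment> \<open>\<open>\<delta>\<close> is the error of replacing the logarithm by its linear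
    term, of order \<open>n * p ^ 4\<close>. Below, \<open>\<eta>\<close> is the logarithm of the
    ratio of joint probability bound to squared single one, up to the factors \<open>1 - p\<close>,
    and is of order \<open>n * p ^ 3\<close>.\<close>
  define \<delta> where "\<delta> n = n * ln (1 - (p n)\<^sup>2) + (141 / 100)\<^sup>2 * ln n" for n :: nat
  define \<nu> where "\<nu> n = (1 - p n) * exp (n * ln (1 - (p n)\<^sup>2))" for n :: nat
  define \<eta> where "\<eta> n = - ((2 * (p n)\<^sup>2 - 4 * p n ^ 3) * (real n - 4)) - 2 * (n * ln (1 - (p n)\<^sup>2))" for n :: nat
  have p: "p \<longlonglongrightarrow> 0" unfolding p_def by real_asymp
  have \<delta>: "\<delta> \<longlonglongrightarrow> 0" unfolding \<delta>_def p_def by real_asymp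
  have \<eta>: "\<eta> \<longlonglongrightarrow> 0" unfolding \<eta>_def p_def by real_asymp
  have A: "filterlim (\<lambda>n::nat. real n * (real n - 1) / 2 * real n powr - (19881/10000)) at_top sequentially"
    by real_asymp
  have "filterlim (\<lambda>n::nat. ((1 - p n) * exp (\<delta> n)) * (real n * (real n - 1) / 2 * real n powr - (19881/10000))) at_top sequentially"
  proof (rule filterlim_tendsto_pos_mult_at_top[OF _ _ A])
    show "(\<lambda>n. (1 - p n) * exp (\<delta> n)) \<longlonglongrightarrow> (1 - 0) * exp 0"
      by (intro tendsto_intros p \<delta>)
  qed simp
  then have 1: "(\<lambda>n. inverse (((1 - p n) * exp (\<delta> n)) * (real n * (real n - 1) / 2 * real n powr - (19881/10000)))) \<longlonglongrightarrow> 0"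
    by (rule tendsto_inverse_0_at_top)
  have 2: "(\<lambda>n. exp (\<eta> n) / (1 - p n)\<^sup>2 - 1) \<longlonglongrightarrow> exp 0 / (1 - 0)\<^sup>2 - 1"
    by (intro tendsto_intros p \<eta>) simp
  have lim: "(\<lambda>n. inverse (((1 - p n) * exp (\<delta> n)) * (real n * (real n - 1) / 2 * real n powr - (19881/10000)))
     + (exp (\<eta> n) / (1 - p n)\<^sup>2 - 1)) \<longlonglongrightarrow> 0"
    using tendsto_add[OF 1 2] by simp
  have half: "\<forall>\<^sub>F n in sequentially. p n < 1 / 2" using p by (rule order_tendstoD) simp
  show ?thesis
  proof (rule tendsto_sandwich[OF _ _ tendsto_const lim])
    show "\<forall>\<^sub>F n in sequentially. measure_pmf.prob (edge_marks n (q n)) {f. diam_le_2 n (marked n Y f)}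
      \<le> inverse (((1 - p n) * exp (\<delta> n)) * (real n * (real n - 1) / 2 * real n powr - (19881/10000)))
         + (exp (\<eta> n) / (1 - p n)\<^sup>2 - 1)"
      using Y half eventually_ge_at_top[of 4]
    proof eventually_elim
      case (elim n)
      have pY: "measure_pmf.prob (q n) Y = p n" using elim by (simp add: p_def)
      have n: "0 < real n" using elim by simp
      have e: "exp (n * ln (1 - (p n)\<^sup>2)) = exp (\<delta> n) * real n powr - (19881 / 10000)"
      proof -
        have "(141 / 100 :: real)\<^sup>2 = 19881 / 10000" by (simp add: power2_eq_square)
        then show ?thesis unfolding \<delta>_def using n by (simp add: powr_def exp_add[symmetric])
      qed
      have \<nu>1: "1 / (real n * (real n - 1) / 2 * \<nu> n) =
        inverse (((1 - p n) * exp (\<delta> n)) * (real n * (real n - 1) / 2 * real n powr - (19881/10000)))"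
        unfolding \<nu>_def e inverse_eq_divide by (simp only: mult_ac)
      have \<nu>2: "exp (- ((2 * (p n)\<^sup>2 - 4 * p n ^ 3) * (real n - 4))) / (\<nu> n)\<^sup>2 = exp (\<eta> n) / (1 - p n)\<^sup>2"
      proof -
        have "(exp (n * ln (1 - (p n)\<^sup>2)))\<^sup>2 = exp (2 * (n * ln (1 - (p n)\<^sup>2)))"
          by (simp add: exp_double)
        then show ?thesis unfolding \<nu>_def \<eta>_def exp_diff power_mult_distrib by simp
      qed
      show ?case
        using prob_diam_le_2[OF q elim(3), of n Y] elim(2)
        unfolding pY \<nu>_def[symmetric] \<nu>1 \<nu>2 by simp
    qed
  qed simp
qed

text \<open>The mean degree is of order \<open>sqrt (n * ln n)\<close>; the bound exceeds it by a
  factor of order \<open>sqrt (ln n)\<close>, which also pays for the union over vertices.\<close>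

lemma prob_degree_tendsto_0:
  fixes q :: "nat \<Rightarrow> nat pmf" and X :: "nat set"
  assumes q: "\<And>n. finite (set_pmf (q n))"
    and X: "\<forall>\<^sub>F n in sequentially. measure_pmf.prob (q n) X = 145 / 100 * sqrt (ln n / n)"
  shows "(\<lambda>n. measure_pmf.prob (edge_marks n (q n))
     {f. \<exists>w<n. ln (real n) * sqrt n < real (card {t. {w, t} \<in> marked n X f})}) \<longlonglongrightarrow> 0"
proof -
  have lim: "(\<lambda>n::nat. n * exp (n * (145/100 * sqrt (ln n / n)) - 69/100 * (ln n * sqrt n))) \<longlonglongrightarrow> 0"
    by real_asymp
  show ?thesis
  proof (rule tendsto_sandwich[OF _ _ tendsto_const lim])
    show "\<forall>\<^sub>F n in sequentially. measure_pmf.prob (edge_marks n (q n))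
     {f. \<exists>w<n. ln (real n) * sqrt n < real (card {t. {w, t} \<in> marked n X f})}
      \<le> n * exp (n * (145/100 * sqrt (ln n / n)) - 69/100 * (ln n * sqrt n))"
      using X eventually_ge_at_top[of 1]
    proof eventually_elim
      case (elim n)
      have "69/100 * (ln n * sqrt n) \<le> ln 2 * (ln n * sqrt n)"
        using ln_2_ge elim by (intro mult_right_mono) auto
      then have "real n * exp (n * (145/100 * sqrt (ln n / n)) - ln 2 * (ln n * sqrt n))
         \<le> n * exp (n * (145/100 * sqrt (ln n / n)) - 69/100 * (ln n * sqrt n))"
        by (intro mult_left_mono) auto
      then show ?case
        using prob_degree_le[OF q[of n], where \<Delta> = "ln (real n) * sqrt n" and n = n and X = X] unfolding elim(1) by linarith
    qed
  qed simp
qed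

text \<open>Up to powers of \<open>ln n\<close> the two terms are of order
  \<open>n powr -0.0207\<close> and \<open>n powr (0.5 - 0.5037)\<close>. Subtracting 6 leaves room
  for the edges coloured by hand, and rounding down costs one more, whence the 7 in the
  estimates.\<close>

lemma eventually_local_lemma_condition:
  defines "k0 \<equiv> \<lambda>n::nat. nat \<lfloor>3 / 100 * ln n - 6\<rfloor>" and "k1 \<equiv> \<lambda>n::nat. nat \<lfloor>73 / 100 * ln n - 6\<rfloor>"
  shows "\<forall>\<^sub>F n in sequentially. 0 < k0 n \<and> real (k0 n + 6) \<le> 3 / 100 * ln n \<and> k0 n \<le> k1 n \<and>
    real (k1 n + 6) \<le> 73 / 100 * ln n \<and>
    4 * real (k1 n) * (real 100 / 2 ^ k0 n + ln n * sqrt n / 2 ^ k1 n) \<le> 1 / 4"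
proof -
  let ?B = "\<lambda>n::nat. 4 * (73/100 * ln n) * (100 * exp (- (69/100 * (3/100 * ln n - 7))) + ln n * sqrt n * exp (-(69/100 * (73/100 * ln n - 7))))"
  have "?B \<longlonglongrightarrow> 0" by real_asymp
  then have "\<forall>\<^sub>F n in sequentially. ?B n < 1 / 4" by (rule order_tendstoD) simp
  moreover have "\<forall>\<^sub>F n::nat in sequentially. 3 / 100 * ln n - 7 \<ge> 0" by real_asymp
  ultimately show ?thesis
    using eventually_ge_at_top[of 1]
  proof eventually_elim
    case (elim n)
    have pos: "0 \<le> ln (real n)" using elim(3) by simp
    have fl: "real (nat \<lfloor>a - 6\<rfloor>) \<le> a - 6 \<and> a - 7 \<le> real (nat \<lfloor>a - 6\<rfloor>)" if "a - 7 \<ge> 0" for a :: real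
      using that by linarith
    have half: "1 / 2 ^ nat \<lfloor>a - 6\<rfloor> \<le> exp (- (69 / 100 * (a - 7)))" if a: "a - 7 \<ge> 0" for a :: real
    proof -
      let ?k = "nat \<lfloor>a - 6\<rfloor>"
      have "69 / 100 * (a - 7) \<le> ln 2 * real ?k"
        using ln_2_ge fl[OF a] a by (intro mult_mono) auto
      then have "exp (69 / 100 * (a - 7)) \<le> exp (ln 2 * real ?k)" by simp
      also have "\<dots> = 2 ^ ?k" by (metis exp_ln exp_of_nat2_mult zero_less_numeral)
      finally show ?thesis by (simp add: exp_minus field_simps)
    qed
    have a0: "3 / 100 * ln n - 7 \<ge> 0" and a1: "73 / 100 * ln n - 7 \<ge> 0"
      using elim(2) pos by linarith+
    have "4 * real (k1 n) * (real 100 / 2 ^ k0 n + ln n * sqrt n / 2 ^ k1 n)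
      = 4 * real (k1 n) * (100 * (1 / 2 ^ k0 n) + ln n * sqrt n * (1 / 2 ^ k1 n))" by simp
    also have "\<dots> \<le> ?B n"
      unfolding k0_def k1_def using half[OF a0] half[OF a1] fl[OF a1] pos
      by (intro mult_mono add_mono) auto
    also have "\<dots> \<le> 1 / 4" using elim(1) by linarith
    finally have "4 * real (k1 n) * (real 100 / 2 ^ k0 n + ln n * sqrt n / 2 ^ k1 n) \<le> 1 / 4" .
    moreover have "k0 n \<le> k1 n"
      unfolding k0_def k1_def using pos by (intro nat_mono floor_mono) auto
    moreover have "0 < k0 n" using a0 by (simp add: k0_def)
    ultimately show ?case using fl[OF a0] fl[OF a1] by (simp add: k0_def k1_def)
  qed
qed

theorem theorem2:
  shows "(\<lambda>n. measure_pmf.prob (random_graph_process n)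
                {es. diam_time n es = rainbow_time n es}) \<longlonglongrightarrow> 1"
proof -
  \<comment> \<open>The thinning probability \<open>141 / 145\<close> turns the factor
    \<open>1.45\<close> into \<open>1.41\<close>.\<close>
  define q where "q n = mark_pmf (145 / 100 * sqrt (ln n / n)) (141 / 145)" for n :: nat
  have fq: "\<And>n. finite (set_pmf (q n))" by (simp add: q_def)
  have "(\<lambda>n::nat. 145 / 100 * sqrt (ln n / n)) \<longlonglongrightarrow> 0" by real_asymp
  then have "\<forall>\<^sub>F n::nat in sequentially. 145 / 100 * sqrt (ln n / n) < 1" by (rule order_tendstoD) simp
  then have "\<forall>\<^sub>F n in sequentially. measure_pmf.prob (q n) {..0} = 141 / 100 * sqrt (ln n / n) \<and>
     measure_pmf.prob (q n) {..1} = 145 / 100 * sqrt (ln n / n)"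
    using eventually_ge_at_top[of 1]
  proof eventually_elim
    case (elim n)
    then show ?case
      using prob_mark_pmf[of "145 / 100 * sqrt (ln n / n)" "141 / 145"] by (simp add: q_def)
  qed
  then have q0: "\<forall>\<^sub>F n in sequentially. measure_pmf.prob (q n) {..0} = 141 / 100 * sqrt (ln n / n)"
    and q1: "\<forall>\<^sub>F n in sequentially. measure_pmf.prob (q n) {..1} = 145 / 100 * sqrt (ln n / n)"
    by (auto elim: eventually_mono)
  let ?J1 = "(\<lambda>i. (1, i)) ` {2..<100 + 2} :: (nat \<times> nat) set" and ?J0 = "(\<lambda>i. (0, i)) ` {2..<100 + 2} :: (nat \<times> nat) set"
  \<comment> \<open>The summands \<open>0 * ln n\<close> and \<open>+ 0\<close> keep every threshold
    in the shape required by the limit lemma for patterns.\<close>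
  define bad :: "nat \<Rightarrow> nat \<Rightarrow> nat set set \<Rightarrow> nat set set \<Rightarrow> bool" where
    "bad i n G0 G1 \<longleftrightarrow>
       (i = 0 \<and> diam_le_2 n G0) \<or>
       (i = 1 \<and> has_pattern n 2 {} {(0, 1)} (0 * ln n + 1) G1 G1) \<or>
       (i = 2 \<and> has_pattern n 3 {} {(0, 1), (0, 2)} (3 / 100 * ln n + 0) G1 G0) \<or>
       (i = 3 \<and> has_pattern n 4 {(0, 2)} {(0, 1), (2, 3)} (3 / 100 * ln n + 0) G1 G0) \<or>
       (i = 4 \<and> has_pattern n 5 {(0, 4), (1, 4), (2, 4), (3, 4)} {(0, 1), (2, 3)} (3 / 100 * ln n + 0) G1 G0) \<or>
       (i = 5 \<and> has_pattern n (100 + 2) ?J1 ?J0 (73 / 100 * ln n + 0) G1 G0) \<or>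
       (i = 6 \<and> (\<exists>w<n. ln (real n) * sqrt n < real (card {t. {w, t} \<in> G1})))" for i n G0 G1
  let ?p = "\<lambda>i n. measure_pmf.prob (edge_marks n (q n)) {f. bad i n (marked n {..0} f) (marked n {..1} f)}"
  have lim: "(\<lambda>n. ?p i n) \<longlonglongrightarrow> 0" if "i < 7" for i
  proof -
    have cJ: "card ?J1 = 100" "card ?J0 = 100" by (simp_all add: card_image inj_on_def)
    consider "i = 0" | "i = 1" | "i = 2" | "i = 3" | "i = 4" | "i = 5" | "i = 6" using \<open>i < 7\<close> by linarith
    then show ?thesis
    proof cases
      case 1
      then show ?thesis unfolding bad_def using prob_diam_le_2_tendsto_0[OF fq q0] by simp
    next
      case 2
      have "(\<lambda>n. measure_pmf.prob (edge_marks n (q n))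
        {f. has_pattern n 2 {} {(0, 1)} (0 * ln n + 1) (marked n {..1} f) (marked n {..1} f)}) \<longlonglongrightarrow> 0"
        \<comment> \<open>The exponent is \<open>2 - 0.99 * 1.45^2 < 0\<close>; as
          \<open>\<beta> = 0\<close>, a small \<open>\<theta>\<close> costs nothing in it.\<close>
        by (rule prob_has_pattern_tendsto_0[OF fq q1 q1, where \<theta> = "1 / 100" and \<sigma> = "ln 100"])
          (auto simp: exp_minus power2_eq_square)
      then show ?thesis unfolding bad_def using 2 by simp
    next
      case 3
      have "(\<lambda>n. measure_pmf.prob (edge_marks n (q n))
        {f. has_pattern n 3 {} {(0, 1), (0, 2)} (3 / 100 * ln n + 0) (marked n {..1} f) (marked n {..0} f)}) \<longlonglongrightarrow> 0"
        by (rule prob_has_pattern_tendsto_0[OF fq q0 q1, where \<theta> = "1 / 20" and \<sigma> = 3])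
          (use exp_minus_3_le in \<open>auto simp: power2_eq_square\<close>)
      then show ?thesis unfolding bad_def using 3 by simp
    next
      case 4
      have "(\<lambda>n. measure_pmf.prob (edge_marks n (q n))
        {f. has_pattern n 4 {(0, 2)} {(0, 1), (2, 3)} (3 / 100 * ln n + 0) (marked n {..1} f) (marked n {..0} f)}) \<longlonglongrightarrow> 0"
        \<comment> \<open>The tightest of the low patterns:
          \<open>4 + 0.18 - 0.5 - 1.9 * 1.9881\<close> is about \<open>-0.097\<close>.\<close>
        by (rule prob_has_pattern_tendsto_0[OF fq q0 q1, where \<theta> = "1 / 20" and \<sigma> = 3])
          (use exp_minus_3_le in \<open>auto simp: power2_eq_square\<close>)
      then show ?thesis unfolding bad_def using 4 by simp
    next
      case 5
      have "(\<lambda>n. measure_pmf.prob (edge_marks n (q n))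
        {f. has_pattern n 5 {(0, 4), (1, 4), (2, 4), (3, 4)} {(0, 1), (2, 3)} (3 / 100 * ln n + 0)
           (marked n {..1} f) (marked n {..0} f)}) \<longlonglongrightarrow> 0"
        by (rule prob_has_pattern_tendsto_0[OF fq q0 q1, where \<theta> = "1 / 20" and \<sigma> = 3])
          (use exp_minus_3_le in \<open>auto simp: power2_eq_square\<close>)
      then show ?thesis unfolding bad_def using 5 by simp
    next
      case 6
      have "(\<lambda>n. measure_pmf.prob (edge_marks n (q n))
        {f. has_pattern n (100 + 2) ?J1 ?J0 (73 / 100 * ln n + 0) (marked n {..1} f) (marked n {..0} f)}) \<longlonglongrightarrow> 0"
      \<comment> \<open>The best \<open>\<theta>\<close> is \<open>0.73 / 1.9881\<close>, almost
        exactly \<open>1 / e\<close>. Each weak pair lowers the exponent by about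
        \<open>0.026\<close>, so 100 of them outweigh the 2 from the free choice of \<open>s\<close>
        and \<open>w\<close>.\<close>
      proof (rule prob_has_pattern_tendsto_0[OF fq q0 q1, where \<theta> = "368 / 1000" and \<sigma> = 1])
        show "real (100 + 2) + real (card ?J0) * (73 / 100) * 1 - real (card ?J1) / 2 -
          (1 - 368 / 1000) * real (card ?J0) * (141 / 100)\<^sup>2 < 0"
          unfolding cJ by (simp add: power2_eq_square)
      qed (use exp_minus_1_le in auto)
      then show ?thesis unfolding bad_def using 6 by simp
    next
      case 7
      then show ?thesis unfolding bad_def using prob_degree_tendsto_0[OF fq q1] by simp
    qed
  qed
  let ?eq = "\<lambda>n es. diam_time n es = rainbow_time n es"
  have bound: "\<forall>\<^sub>F n in sequentially. 1 - (\<Sum>i<7. ?p i n) \<le> measure_pmf.prob (random_graph_process n) {es. ?eq n es}"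
    using eventually_local_lemma_condition
  proof eventually_elim
    case (elim n)
    have det: "\<exists>i<7. bad i n (graph_at es s) (graph_at es t)"
      if es: "es \<in> permutations_of_set (complete_edges n)" "\<not> ?eq n es" and st: "graph_at es s \<subseteq> graph_at es t" for es s t
    proof (rule ccontr)
      assume "\<not> ?thesis"
      then have nb: "\<not> bad i n (graph_at es s) (graph_at es t)" if "i < 7" for i using that by blast
      have G1: "graph_at es t \<subseteq> complete_edges n"
        using es set_take_subset[of t es] by (auto simp: graph_at_def permutations_of_set_def)
      let ?lo = "3 / 100 * ln (real n)" and ?hi = "73 / 100 * ln (real n)"
      let ?pat = "\<lambda>k JA JH b. has_pattern n k JA JH b (graph_at es t) (graph_at es s)"
      have P: "\<not> ?pat 3 {} {(0, 1), (0, 2)} ?lo" "\<not> ?pat 4 {(0, 2)} {(0, 1), (2, 3)} ?lo"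
        "\<not> ?pat 5 {(0, 4), (1, 4), (2, 4), (3, 4)} {(0, 1), (2, 3)} ?lo"
        "\<not> ?pat (100 + 2) ?J1 ?J0 ?hi"
        using nb[of 2] nb[of 3] nb[of 4] nb[of 5] by (simp_all add: bad_def)
      have deg: "card {u. {w, u} \<in> graph_at es t} \<le> ln (real n) * sqrt n" if "w < n" for w
      proof (rule ccontr)
        assume "\<not> card {u. {w, u} \<in> graph_at es t} \<le> ln (real n) * sqrt n"
        then have "bad 6 n (graph_at es s) (graph_at es t)"
          using that unfolding bad_def not_le by blast
        then show False using nb[of 6] by simp
      qed
      obtain k0 k1 where c: "0 < k0" "real (k0 + 6) \<le> ?lo" "k0 \<le> k1" "real (k1 + 6) \<le> ?hi"
        "4 * real k1 * (real 100 / 2 ^ k0 + ln (real n) * sqrt n / 2 ^ k1) \<le> 1 / 4"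
        using elim by blast
      have "sparse_pair n (graph_at es s) (graph_at es t) ?lo ?hi (ln (real n) * sqrt n) 100 k0 k1"
        by (rule sparse_pairI[OF st G1 P deg]) (use c in simp_all)
      moreover have "\<not> diam_le_2 n (graph_at es s)" using nb[of 0] by (simp add: bad_def)
      moreover have "diam_le_2 n (graph_at es t)"
        using nb[of 1] by (intro diam_le_2_if_no_pattern[OF G1]) (simp add: bad_def)
      ultimately show False using diam_time_eq_rainbow_time[OF es(1)] es(2) by blast
    qed
    \<comment> \<open>Inclusion becomes a premise inside \<open>Q\<close> because the coupling
      ranges over times in either order; mark graphs are nested anyway.\<close>
    have "measure_pmf.prob (random_graph_process n) {es. \<not> ?eq n es}
      \<le> measure_pmf.prob (edge_marks n (q n))
         {f. marked n {..0} f \<subseteq> marked n {..1} f \<longrightarrow> (\<exists>i<7. bad i n (marked n {..0} f) (marked n {..1} f))}"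
      by (rule prob_process_le_prob_marks[where Q = "\<lambda>G0 G1. G0 \<subseteq> G1 \<longrightarrow> (\<exists>i<7. bad i n G0 G1)"])
        (use det in blast)
    also have "{f. marked n {..0} f \<subseteq> marked n {..1} f \<longrightarrow> (\<exists>i<7. bad i n (marked n {..0} f) (marked n {..1} f))}
        = (\<Union>i\<in>{..<7}. {f. bad i n (marked n {..0} f) (marked n {..1} f)})"
      by (auto simp: marked_def)
    also have "measure_pmf.prob (edge_marks n (q n)) \<dots> \<le> (\<Sum>i<7. ?p i n)"
      by (rule measure_pmf.finite_measure_subadditive_finite) auto
    finally have "measure_pmf.prob (random_graph_process n) {es. \<not> ?eq n es} \<le> (\<Sum>i<7. ?p i n)" .
    moreover have "measure_pmf.prob (random_graph_process n) {es. \<not> ?eq n es} =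
        1 - measure_pmf.prob (random_graph_process n) {es. ?eq n es}"
      by (rule measure_pmf.prob_neg[simplified])
    ultimately show ?case by linarith
  qed
  have "(\<lambda>n. 1 - (\<Sum>i<7. ?p i n)) \<longlonglongrightarrow> 1 - (\<Sum>i<7::nat. 0)"
    by (intro tendsto_intros lim) auto
  then have lower: "(\<lambda>n. 1 - (\<Sum>i<7. ?p i n)) \<longlonglongrightarrow> 1" by simp
  show ?thesis
    by (rule tendsto_sandwich[OF bound _ lower tendsto_const]) auto
qed

end
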